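(* Let $a>0$, $b>0$. Let $(\mu_n)_n$ be a sequence in $\mathcal{M}^s(\mathbb{R}^d)$ and $\mu\in\mathcal{M}^s(\mathbb{R}^d)$. Let $\mu=\mu^+-\mu^-$ be the Jordan decomposition of $\mu$ and, for each $n$, let $\mu_n=\mu_n^+-\mu_n^-$ be any decomposition with $\mu_n^+,\mu_n^-\in\mathcal{M}(\mathbb{R}^d)$. The following two statements are equivalent: (i) $\|\mu_n-\mu\|^{a,b}\to0$ as $n\to\infty$; (ii) there exist, for each $n$, four positive measures $z_n^+,z_n^-,m_n^+,m_n^-\in\mathcal{M}(\mathbb{R}^d)$ such that $$\mu_n^+=z_n^++m_n^+,\qquad \mu_n^-=z_n^-+m_n^-,$$ with $W_1^{a,b}(z_n^+,z_n^-)\to0$, $W_1^{a,b}(m_n^+,\mu^+)\to0$ and $W_1^{a,b}(m_n^-,\mu^-)\to0$ as $n\to\infty$, and the sequences $(m_n^+)_n$ and $(m_n^-)_n$ are tight and bounded in mass.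
   Context: $\mathcal{M}(\mathbb{R}^d)$ is the set of positive Borel (Radon) measures on $\mathbb{R}^d$ with finite mass; $\mathcal{M}^s(\mathbb{R}^d)$ is the vector space of signed measures $\mu=\mu_+-\mu_-$ with $\mu_\pm\in\mathcal{M}(\mathbb{R}^d)$; $|\mu|$ denotes the total mass (total variation) of $\mu$. A sequence $(m_n)$ in $\mathcal{M}(\mathbb{R}^d)$ is tight if for each $\varepsilon>0$ there is a compact $K\subset\mathbb{R}^d$ with $m_n(\mathbb{R}^d\setminus K)<\varepsilon$ for all $n$; it is bounded in mass if $\sup_n|m_n|<\infty$. For $\tilde\mu,\tilde\nu\in\mathcal{M}(\mathbb{R}^d)$ of equal mass, $W_1(\tilde\mu,\tilde\nu)=\min_{\pi}\int|x-y|\,d\pi(x,y)$ over positive measures $\pi$ on $\mathbb{R}^d\times\mathbb{R}^d$ with marginals $\tilde\mu,\tilde\nu$. For $\mu,\nu\in\mathcal{M}(\mathbb{R}^d)$, $$W_1^{a,b}(\mu,\nu)=\inf\{a(|\mu-\tilde\mu|+|\nu-\tilde\nu|)+bW_1(\tilde\mu,\tilde\nu):\ \tilde\mu,\tilde\nu\in\mathcal{M}(\mathbb{R}^d),\ |\tilde\mu|=|\tilde\nu|\}.$$ For $\mu\in\mathcal{M}^s(\mathbb{R}^d)$, $\|\mu\|^{a,b}=W_1^{a,b}(\mu_+,\mu_-)$, where $\mu=\mu_+-\mu_-$ is any decomposition with $\mu_\pm\in\mathcal{M}(\mathbb{R}^d)$ (the value does not depend on the decomposition). *)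

theory Defs
  imports "HOL-Probability.Probability"
begin

text \<open>Finite positive Borel measures; on a Euclidean space they are automatically Radon.\<close>

definition fin_borel_measures :: "'a::euclidean_space measure set" where
  "fin_borel_measures = {M. sets M = sets borel \<and> finite_measure M}"

text \<open>
  A signed measure is represented by its real-valued set function. Since \<^const>\<open>measure\<close> is zero
  on non-measurable sets, so is every signed measure, hence equality and subtraction of signed
  measures are equality and pointwise subtraction of functions.
\<close>

definition decomposes ::
    "('a::euclidean_space set \<Rightarrow> real) \<Rightarrow> 'a measure \<Rightarrow> 'a measure \<Rightarrow> bool" where
  "decomposes \<nu> P N \<longleftrightarrow> P \<in> fin_borel_measures \<and> N \<in> fin_borel_measures \<and>
     \<nu> = (\<lambda>A. measure P A - measure N A)"

definition signed_measures :: "('a::euclidean_space set \<Rightarrow> real) set" where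
  "signed_measures = {\<nu>. \<exists>P N. decomposes \<nu> P N}"

definition jordan_decomposition ::
    "('a::euclidean_space set \<Rightarrow> real) \<Rightarrow> 'a measure \<Rightarrow> 'a measure \<Rightarrow> bool" where
  "jordan_decomposition \<nu> P N \<longleftrightarrow> decomposes \<nu> P N \<and>
     (\<exists>H \<in> sets borel. measure P (- H) = 0 \<and> measure N H = 0)"

definition total_variation :: "('a::euclidean_space set \<Rightarrow> real) \<Rightarrow> ennreal" where
  "total_variation \<nu> =
     (SUP F \<in> {F. finite F \<and> F \<subseteq> sets borel \<and> partition_on UNIV F}. ennreal (\<Sum>A\<in>F. \<bar>\<nu> A\<bar>))"

text \<open>For a positive measure the total variation is the total mass.\<close>

lemma total_variation_measure:
  fixes M :: "'a::euclidean_space measure"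
  assumes "M \<in> fin_borel_measures"
  shows "total_variation (measure M) = emeasure M UNIV"
proof -
  interpret finite_measure M using assms by (simp add: fin_borel_measures_def)
  have sM: "sets M = sets borel" using assms by (simp add: fin_borel_measures_def)
  have eq: "ennreal (\<Sum>A\<in>F. \<bar>measure M A\<bar>) = emeasure M UNIV"
    if "finite F" "F \<subseteq> sets borel" "partition_on UNIV F" for F
  proof -
    have "(\<Sum>A\<in>F. \<bar>measure M A\<bar>) = (\<Sum>A\<in>F. measure M A)" by simp
    also have "\<dots> = measure M (\<Union>A\<in>F. A)"
      using that sM by (intro finite_measure_finite_Union[symmetric])
        (auto simp: partition_on_def disjoint_family_on_def disjoint_def)
    also have "(\<Union>A\<in>F. A) = UNIV" using that by (simp add: partition_on_def)
    finally show ?thesis by (simp add: emeasure_eq_measure)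
  qed
  let ?S = "{F :: 'a set set. finite F \<and> F \<subseteq> sets borel \<and> partition_on UNIV F}"
  have "{UNIV} \<in> ?S" by (auto simp: partition_on_def)
  then have "?S \<noteq> {}" by blast
  moreover have "total_variation (measure M) = (SUP F \<in> ?S. emeasure M UNIV)"
    unfolding total_variation_def by (intro SUP_cong refl eq) auto
  ultimately show ?thesis by simp
qed

text \<open>Transport plans, and the Wasserstein distance (possibly infinite, as no moments are assumed).\<close>

definition couplings ::
    "'a::euclidean_space measure \<Rightarrow> 'a measure \<Rightarrow> ('a \<times> 'a) measure set" where
  "couplings M N = {\<pi>. sets \<pi> = sets (borel \<Otimes>\<^sub>M borel) \<and> distr \<pi> borel fst = M \<and> distr \<pi> borel snd = N}"

definition W1 :: "'a::euclidean_space measure \<Rightarrow> 'a measure \<Rightarrow> ennreal" where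
  "W1 M N = (INF \<pi> \<in> couplings M N. \<integral>\<^sup>+ (x, y). ennreal (dist x y) \<partial>\<pi>)"

definition W1ab ::
    "real \<Rightarrow> real \<Rightarrow> 'a::euclidean_space measure \<Rightarrow> 'a measure \<Rightarrow> ennreal" where
  "W1ab a b M N =
     (INF (M', N') \<in> {(M', N'). M' \<in> fin_borel_measures \<and> N' \<in> fin_borel_measures \<and>
                         emeasure M' UNIV = emeasure N' UNIV}.
        ennreal a * (total_variation (\<lambda>A. measure M A - measure M' A)
                   + total_variation (\<lambda>A. measure N A - measure N' A))
        + ennreal b * W1 M' N')"

text \<open>
  The choice picks an arbitrary decomposition of the signed measure; for \<open>a, b > 0\<close> the value does
  not depend on which one.
\<close>

definition norm_ab :: "real \<Rightarrow> real \<Rightarrow> ('a::euclidean_space set \<Rightarrow> real) \<Rightarrow> ennreal" where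
  "norm_ab a b \<nu> = (SOME w. \<exists>P N. decomposes \<nu> P N \<and> w = W1ab a b P N)"

definition tight_seq :: "(nat \<Rightarrow> 'a::euclidean_space measure) \<Rightarrow> bool" where
  "tight_seq m \<longleftrightarrow> (\<forall>\<epsilon>>0. \<exists>K. compact K \<and> (\<forall>n. measure (m n) (UNIV - K) < \<epsilon>))"

definition bounded_in_mass :: "(nat \<Rightarrow> 'a::euclidean_space measure) \<Rightarrow> bool" where
  "bounded_in_mass m \<longleftrightarrow> (SUP n. emeasure (m n) UNIV) < \<infinity>"

text \<open>\<open>M\<close> is the sum of the measures \<open>P\<close> and \<open>Q\<close>.\<close>

definition is_measure_sum ::
    "'a::euclidean_space measure \<Rightarrow> 'a measure \<Rightarrow> 'a measure \<Rightarrow> bool" where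
  "is_measure_sum M P Q \<longleftrightarrow> (\<forall>A \<in> sets borel. emeasure M A = emeasure P A + emeasure Q A)"

end

theory Submission imports Defs begin

text \<open>
  Since \<open>norm_ab\<close> may use any decomposition, the crux is a cancellation property: if
  \<open>P - N = M - L\<close> then \<open>W1ab P N \<le> W1ab M L\<close>. It is obtained without Kantorovich duality. Cutting a
  large ball into small cells turns a near-optimal competitor for \<open>(M, L)\<close> into a flow on a finite
  graph whose cost involves only the values of \<open>M - L\<close> on the cells. A finite flow with divergence
  \<open>p - n\<close> is converted into a transport plan from \<open>p\<close> to \<open>n\<close> by shortcutting the mass that merely
  passes through a vertex, which the triangle inequality makes no more expensive. The discrete
  plan is then spread over the cells as a step density with respect to \<open>P \<otimes> N\<close>.

  For (i) \<open>\<Longrightarrow>\<close> (ii), take such a density \<open>w\<close> for \<open>P = \<mu>\<^sub>n\<^sup>+ + \<mu>\<^sup>-\<close> and \<open>N = \<mu>\<^sub>n\<^sup>- + \<mu>\<^sup>+\<close>, and let \<open>m\<^sub>n\<^sup>+\<close> be the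
  part of \<open>\<mu>\<^sub>n\<^sup>+\<close> that \<open>w\<close> sends to \<open>\<mu>\<^sup>+\<close>, and \<open>m\<^sub>n\<^sup>-\<close> the part of \<open>\<mu>\<^sub>n\<^sup>-\<close> that it takes from \<open>\<mu>\<^sup>-\<close>. Almost all
  of \<open>\<mu>\<^sup>+\<close> is reached from \<open>\<mu>\<^sub>n\<^sup>+\<close>, because sending mass from \<open>\<mu>\<^sup>-\<close> to the mutually singular
  \<open>\<mu>\<^sup>+\<close> has a cost bounded below. For (ii) \<open>\<Longrightarrow>\<close> (i), the three flows add up.
\<close>

section \<open>Flows and transport plans on finite graphs\<close>

text \<open>The obstacle is that competitors in \<open>W1ab\<close> are tied to the given measures
  only through total variation: \<open>M'\<close> need not lie below \<open>M\<close>, and a part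
  common to \<open>M\<close> and \<open>L\<close> may serve as a relay station for the transport. A
  coupling for \<open>(M, L)\<close> therefore says nothing directly about another pair
  \<open>(P, N)\<close> with the same difference; what survives is its divergence, and a flow
  records just that. On a finite graph the relays can be removed by induction over the vertices. The
  result is given as a density with respect to \<open>P \<Otimes>\<^sub>M N\<close>, not as a
  coupling, because densities split: if \<open>P\<close> and \<open>N\<close> are sums of two
  measures, integrating the same function against the summands yields the four blocks of the plan,
  with no disintegration. The errors of the passage to cells and back are of two kinds only, tails
  outside a large ball and mesh size times mass, and both vanish along one index.\<close>

lemma flow_shortcut:
  fixes \<rho> d :: "'i \<Rightarrow> 'i \<Rightarrow> real" and p n :: "'i \<Rightarrow> real"
  assumes fin: "finite I" and k: "k \<in> I"
    and nonneg: "\<And>i j. i \<in> I \<Longrightarrow> j \<in> I \<Longrightarrow> 0 \<le> \<rho> i j"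
    and p: "0 \<le> p k" and n: "0 \<le> n k"
    and div: "\<And>i. i \<in> I \<Longrightarrow> (\<Sum>j\<in>I. \<rho> i j) - (\<Sum>j\<in>I. \<rho> j i) = p i - n i"
    and d: "\<And>i j. 0 \<le> d i j" "\<And>i j l. d i j \<le> d i l + d l j"
  shows "\<exists>\<sigma>. (\<forall>i\<in>I. \<forall>j\<in>I. 0 \<le> \<sigma> i j) \<and>
      (\<forall>i\<in>I. (\<Sum>j\<in>I. \<sigma> i j) - (\<Sum>j\<in>I. \<sigma> j i) = p i - n i) \<and>
      (\<Sum>i\<in>I. \<Sum>j\<in>I. \<sigma> i j * d i j) \<le> (\<Sum>i\<in>I. \<Sum>j\<in>I. \<rho> i j * d i j) \<and>
      (\<Sum>i\<in>I. \<sigma> i k) \<le> n k \<and>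
      (\<forall>j\<in>I. j \<noteq> k \<longrightarrow> (\<Sum>i\<in>I. \<sigma> i j) = (\<Sum>i\<in>I. \<rho> i j))"
proof -
  \<comment> \<open>The loop at \<open>k\<close> is deleted. It counts equally as inflow and
    outflow, and with \<open>\<rho>' k k = 0\<close> no positive entry is reduced twice, as an edge
    into \<open>k\<close> and as an edge out of \<open>k\<close>; this keeps the rerouted flow
    nonnegative.\<close>
  define \<rho>' where "\<rho>' i j = \<rho> i j - (if i = k then if j = k then \<rho> k k else 0 else 0)" for i j
  have nonneg': "0 \<le> \<rho>' i j" "\<rho>' i j \<le> \<rho> i j" if "i \<in> I" "j \<in> I" for i j
    using nonneg[OF that] by (auto simp: \<rho>'_def)
  have kk: "\<rho>' k k = 0" by (simp add: \<rho>'_def)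
  have row': "(\<Sum>j\<in>I. \<rho>' i j) = (\<Sum>j\<in>I. \<rho> i j) - (if i = k then \<rho> k k else 0)" for i
    using fin k by (simp add: \<rho>'_def sum_subtractf)
  have col': "(\<Sum>i\<in>I. \<rho>' i j) = (\<Sum>i\<in>I. \<rho> i j) - (if j = k then \<rho> k k else 0)" for j
    using fin k by (simp add: \<rho>'_def sum_subtractf)
  have div': "(\<Sum>j\<in>I. \<rho>' i j) - (\<Sum>j\<in>I. \<rho>' j i) = p i - n i" if "i \<in> I" for i
    using div[OF that] by (simp add: row' col')
  have cost': "(\<Sum>i\<in>I. \<Sum>j\<in>I. \<rho>' i j * d i j) \<le> (\<Sum>i\<in>I. \<Sum>j\<in>I. \<rho> i j * d i j)"
    using nonneg' d(1) by (intro sum_mono mult_right_mono) auto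
  define inn where "inn = (\<Sum>i\<in>I. \<rho>' i k)"
  define out where "out = (\<Sum>j\<in>I. \<rho>' k j)"
  \<comment> \<open>\<open>s\<close> is the inflow that \<open>n k\<close> cannot absorb. By the
    divergence equation it is also the outflow not supplied by \<open>p k\<close>, hence at most
    \<open>inn\<close> and at most \<open>out\<close>: the mass that merely passes through.\<close>
  define s where "s = inn - n k"
  have s_out: "s = out - p k" using div'[OF k] by (simp add: s_def inn_def out_def)
  show ?thesis
  proof (cases "s \<le> 0")
    case True
    show ?thesis
    proof (intro exI[of _ \<rho>'] conjI ballI impI)
      show "(\<Sum>i\<in>I. \<rho>' i k) \<le> n k" using True by (simp add: s_def inn_def)
    qed (use nonneg' div' cost' col' in auto)
  next
    case False
    then have s: "0 < s" "s \<le> inn" "s \<le> out" using p n s_out by (auto simp: s_def)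
    then have pos: "0 < inn" "0 < out" by auto
    \<comment> \<open>A product coupling of mass \<open>s\<close> between the normalised incoming
      and outgoing edges of \<open>k\<close>. Sending \<open>t i j\<close> directly from
      \<open>i\<close> to \<open>j\<close> restores every row and column sum except those of
      \<open>k\<close>, which both drop by \<open>s\<close>.\<close>
    define t where "t i j = s * (\<rho>' i k / inn) * (\<rho>' k j / out)" for i j
    define \<sigma> where "\<sigma> i j = \<rho>' i j - (if j = k then s * (\<rho>' i k / inn) else 0)
        - (if i = k then s * (\<rho>' k j / out) else 0) + t i j" for i j
    have t_row: "(\<Sum>j\<in>I. t i j) = s * (\<rho>' i k / inn)" for i
    proof -
      have "(\<Sum>j\<in>I. t i j) = s * (\<rho>' i k / inn) * ((\<Sum>j\<in>I. \<rho>' k j) / out)"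
        by (simp add: t_def sum_distrib_left sum_divide_distrib)
      then show ?thesis using pos by (simp add: out_def)
    qed
    have t_col: "(\<Sum>i\<in>I. t i j) = s * (\<rho>' k j / out)" for j
    proof -
      have "(\<Sum>i\<in>I. t i j) = s * ((\<Sum>i\<in>I. \<rho>' i k) / inn) * (\<rho>' k j / out)"
        by (simp add: t_def sum_distrib_left sum_distrib_right sum_divide_distrib)
      then show ?thesis using pos by (simp add: inn_def)
    qed
    have in1: "(\<Sum>i\<in>I. s * (\<rho>' i k / inn)) = s"
      using pos by (simp add: sum_distrib_left[symmetric] sum_divide_distrib[symmetric] flip: inn_def)
    have out1: "(\<Sum>j\<in>I. s * (\<rho>' k j / out)) = s"
      using pos by (simp add: sum_distrib_left[symmetric] sum_divide_distrib[symmetric] flip: out_def)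
    have row: "(\<Sum>j\<in>I. \<sigma> i j) = (\<Sum>j\<in>I. \<rho>' i j) - (if i = k then s else 0)" for i
      using fin k out1 by (simp add: \<sigma>_def sum.distrib sum_subtractf t_row)
    have col: "(\<Sum>i\<in>I. \<sigma> i j) = (\<Sum>i\<in>I. \<rho>' i j) - (if j = k then s else 0)" for j
      using fin k in1 by (simp add: \<sigma>_def sum.distrib sum_subtractf t_col)
    have t_nonneg: "0 \<le> t i j" if "i \<in> I" "j \<in> I" for i j
      using that nonneg' s pos k by (simp add: t_def)
    have \<sigma>_nonneg: "0 \<le> \<sigma> i j" if ij: "i \<in> I" "j \<in> I" for i j
    proof -
      have *: "s * (\<rho>' i k / inn) \<le> \<rho>' i k" "s * (\<rho>' k j / out) \<le> \<rho>' k j"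
        using s pos nonneg'(1)[of i k] nonneg'(1)[of k j] ij k
        by (simp_all add: pos_divide_le_eq mult.commute[of "\<rho>' _ _"] mult_right_mono)
      show ?thesis using * t_nonneg[OF ij] nonneg'(1)[OF ij] kk by (auto simp: \<sigma>_def)
    qed
    have t_cost: "(\<Sum>i\<in>I. \<Sum>j\<in>I. t i j * d i j)
       \<le> (\<Sum>i\<in>I. s * (\<rho>' i k / inn) * d i k) + (\<Sum>j\<in>I. s * (\<rho>' k j / out) * d k j)"
    proof -
      have "(\<Sum>i\<in>I. \<Sum>j\<in>I. t i j * d i j) \<le> (\<Sum>i\<in>I. \<Sum>j\<in>I. t i j * (d i k + d k j))"
        using t_nonneg d by (intro sum_mono mult_left_mono) auto
      also have "\<dots> = (\<Sum>i\<in>I. (\<Sum>j\<in>I. t i j) * d i k) + (\<Sum>i\<in>I. \<Sum>j\<in>I. t i j * d k j)"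
        by (simp add: distrib_left sum.distrib sum_distrib_right)
      also have "(\<Sum>i\<in>I. \<Sum>j\<in>I. t i j * d k j) = (\<Sum>j\<in>I. (\<Sum>i\<in>I. t i j) * d k j)"
        by (subst sum.swap) (simp add: sum_distrib_right)
      finally show ?thesis by (simp add: t_row t_col)
    qed
    have cost: "(\<Sum>i\<in>I. \<Sum>j\<in>I. \<sigma> i j * d i j) = (\<Sum>i\<in>I. \<Sum>j\<in>I. \<rho>' i j * d i j)
       - (\<Sum>i\<in>I. s * (\<rho>' i k / inn) * d i k) - (\<Sum>j\<in>I. s * (\<rho>' k j / out) * d k j)
       + (\<Sum>i\<in>I. \<Sum>j\<in>I. t i j * d i j)"
    proof -
      have "\<sigma> i j * d i j = \<rho>' i j * d i j - (if j = k then s * (\<rho>' i k / inn) * d i k else 0)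
        - (if i = k then s * (\<rho>' k j / out) * d k j else 0) + t i j * d i j" for i j
        by (simp add: \<sigma>_def algebra_simps)
      moreover have "(\<Sum>i\<in>I. \<Sum>j\<in>I. if i = k then s * (\<rho>' k j / out) * d k j else 0)
        = (\<Sum>j\<in>I. s * (\<rho>' k j / out) * d k j)"
        using fin k by (subst sum.swap) simp
      ultimately show ?thesis using fin k by (simp add: sum.distrib sum_subtractf)
    qed
    show ?thesis
    proof (intro exI[of _ \<sigma>] conjI ballI impI)
      show "(\<Sum>i\<in>I. \<sigma> i k) \<le> n k" by (simp add: col s_def inn_def)
      show "(\<Sum>i\<in>I. \<Sum>j\<in>I. \<sigma> i j * d i j) \<le> (\<Sum>i\<in>I. \<Sum>j\<in>I. \<rho> i j * d i j)"
        using cost t_cost cost' by linarith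
      show "(\<Sum>j\<in>I. \<sigma> i j) - (\<Sum>j\<in>I. \<sigma> j i) = p i - n i" if "i \<in> I" for i
        using div'[OF that] by (simp add: row col)
      show "(\<Sum>i\<in>I. \<sigma> i j) = (\<Sum>i\<in>I. \<rho> i j)" if "j \<in> I" "j \<noteq> k" for j
        using that by (simp add: col col')
    qed (use \<sigma>_nonneg in auto)
  qed
qed

text \<open>The vertices are shortcut one after another. Treating \<open>k\<close> leaves the inflow
  into every other vertex unchanged, so bounds achieved earlier survive and finally no vertex
  receives more than \<open>n\<close>. What is then still missing is mass that stays where it
  is.\<close>

lemma flow_to_transport:
  fixes \<rho> d :: "'i \<Rightarrow> 'i \<Rightarrow> real" and p n :: "'i \<Rightarrow> real"
  assumes fin: "finite I"
    and nonneg: "\<And>i j. i \<in> I \<Longrightarrow> j \<in> I \<Longrightarrow> 0 \<le> \<rho> i j"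
    and pn: "\<And>i. i \<in> I \<Longrightarrow> 0 \<le> p i" "\<And>i. i \<in> I \<Longrightarrow> 0 \<le> n i"
    and div: "\<And>i. i \<in> I \<Longrightarrow> (\<Sum>j\<in>I. \<rho> i j) - (\<Sum>j\<in>I. \<rho> j i) = p i - n i"
    and d: "\<And>i j. 0 \<le> d i j" "\<And>i j l. d i j \<le> d i l + d l j" "\<And>i. d i i = 0"
  shows "\<exists>\<sigma>. (\<forall>i\<in>I. \<forall>j\<in>I. 0 \<le> \<sigma> i j) \<and>
      (\<forall>i\<in>I. (\<Sum>j\<in>I. \<sigma> i j) = p i) \<and>
      (\<forall>j\<in>I. (\<Sum>i\<in>I. \<sigma> i j) = n j) \<and>
      (\<Sum>i\<in>I. \<Sum>j\<in>I. \<sigma> i j * d i j) \<le> (\<Sum>i\<in>I. \<Sum>j\<in>I. \<rho> i j * d i j)"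
proof -
  let ?good = "\<lambda>S \<sigma>. (\<forall>i\<in>I. \<forall>j\<in>I. 0 \<le> \<sigma> i j) \<and>
      (\<forall>i\<in>I. (\<Sum>j\<in>I. \<sigma> i j) - (\<Sum>j\<in>I. \<sigma> j i) = p i - n i) \<and>
      (\<Sum>i\<in>I. \<Sum>j\<in>I. \<sigma> i j * d i j) \<le> (\<Sum>i\<in>I. \<Sum>j\<in>I. \<rho> i j * d i j) \<and>
      (\<forall>k\<in>S. (\<Sum>i\<in>I. \<sigma> i k) \<le> n k)"
  have "\<exists>\<sigma>. ?good S \<sigma>" if "finite S" "S \<subseteq> I" for S
    using that
  proof (induction S)
    case empty
    show ?case using nonneg div by (intro exI[of _ \<rho>]) auto
  next
    case (insert k S)
    then obtain \<sigma> where good: "?good S \<sigma>" by auto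
    then have \<sigma>: "\<And>i j. i \<in> I \<Longrightarrow> j \<in> I \<Longrightarrow> 0 \<le> \<sigma> i j"
      "\<And>i. i \<in> I \<Longrightarrow> (\<Sum>j\<in>I. \<sigma> i j) - (\<Sum>j\<in>I. \<sigma> j i) = p i - n i"
      by auto
    have k: "k \<in> I" using insert by simp
    obtain \<tau> where "\<And>i j. i \<in> I \<Longrightarrow> j \<in> I \<Longrightarrow> 0 \<le> \<tau> i j"
      "\<And>i. i \<in> I \<Longrightarrow> (\<Sum>j\<in>I. \<tau> i j) - (\<Sum>j\<in>I. \<tau> j i) = p i - n i"
      "(\<Sum>i\<in>I. \<Sum>j\<in>I. \<tau> i j * d i j) \<le> (\<Sum>i\<in>I. \<Sum>j\<in>I. \<sigma> i j * d i j)"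
      "(\<Sum>i\<in>I. \<tau> i k) \<le> n k"
      "\<And>j. j \<in> I \<Longrightarrow> j \<noteq> k \<Longrightarrow> (\<Sum>i\<in>I. \<tau> i j) = (\<Sum>i\<in>I. \<sigma> i j)"
    using flow_shortcut[where d = d, OF fin k \<sigma>(1) pn(1)[OF k] pn(2)[OF k] \<sigma>(2) d(1,2)] by blast
    moreover have "(\<Sum>i\<in>I. \<tau> i j) \<le> n j" if "j \<in> S" for j
    proof -
      have "j \<in> I" "j \<noteq> k" using that insert by auto
      then show ?thesis using calculation(5)[of j] good that by simp
    qed
    ultimately have "?good (insert k S) \<tau>"
      using good by (auto intro: order_trans)
    then show ?case by blast
  qed
  from this[OF fin order_refl] obtain \<sigma> where \<sigma>: "?good I \<sigma>" ..
  \<comment> \<open>The missing inflow becomes a loop, free because \<open>d i i = 0\<close>. A loop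
    raises inflow and outflow alike, so once the inflow at \<open>i\<close> is \<open>n i\<close>,
    the divergence equation makes the outflow \<open>p i\<close>.\<close>
  define \<tau> where "\<tau> i j = \<sigma> i j + (if i = j then n i - (\<Sum>l\<in>I. \<sigma> l i) else 0)" for i j
  show ?thesis
  proof (intro exI[of _ \<tau>] conjI ballI impI)
    show "0 \<le> \<tau> i j" if "i \<in> I" "j \<in> I" for i j
      using that \<sigma> by (simp add: \<tau>_def)
    show "(\<Sum>j\<in>I. \<tau> i j) = p i" if "i \<in> I" for i
    proof -
      have "(\<Sum>j\<in>I. \<tau> i j) = (\<Sum>j\<in>I. \<sigma> i j) + (n i - (\<Sum>l\<in>I. \<sigma> l i))"
        using that fin by (simp add: \<tau>_def sum.distrib)
      then show ?thesis using \<sigma> that by (simp add: algebra_simps)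
    qed
    show "(\<Sum>i\<in>I. \<tau> i j) = n j" if "j \<in> I" for j
    proof -
      have "(\<Sum>i\<in>I. \<tau> i j) = (\<Sum>i\<in>I. \<sigma> i j) + (\<Sum>i\<in>I. if i = j then n j - (\<Sum>l\<in>I. \<sigma> l j) else 0)"
        unfolding \<tau>_def sum.distrib by (intro arg_cong2[where f="(+)"] refl sum.cong) auto
      then show ?thesis using that fin by simp
    qed
    have eq: "\<tau> i j * d i j = \<sigma> i j * d i j" for i j using d(3) by (simp add: \<tau>_def)
    show "(\<Sum>i\<in>I. \<Sum>j\<in>I. \<tau> i j * d i j) \<le> (\<Sum>i\<in>I. \<Sum>j\<in>I. \<rho> i j * d i j)"
      unfolding eq using \<sigma> by blast
  qed
qed

text \<open>A flow whose divergence misses \<open>p - n\<close> is exact for enlarged marginals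
  \<open>p'\<close> and \<open>n'\<close>. The plan for these is thinned back by a survival factor
  at each endpoint; the mass lost is charged to the defect at rate \<open>a\<close>, and thinning
  never raises the transport cost.\<close>

lemma flow_to_partial_transport:
  fixes \<rho> d :: "'i \<Rightarrow> 'i \<Rightarrow> real" and p n :: "'i \<Rightarrow> real" and a b :: real
  assumes fin: "finite I" and ab: "0 \<le> a" "0 \<le> b"
    and nonneg: "\<And>i j. i \<in> I \<Longrightarrow> j \<in> I \<Longrightarrow> 0 \<le> \<rho> i j"
    and pn: "\<And>i. i \<in> I \<Longrightarrow> 0 \<le> p i" "\<And>i. i \<in> I \<Longrightarrow> 0 \<le> n i"
    and d: "\<And>i j. 0 \<le> d i j" "\<And>i j l. d i j \<le> d i l + d l j" "\<And>i. d i i = 0"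
  shows "\<exists>\<sigma>. (\<forall>i\<in>I. \<forall>j\<in>I. 0 \<le> \<sigma> i j) \<and>
      (\<forall>i\<in>I. (\<Sum>j\<in>I. \<sigma> i j) \<le> p i) \<and>
      (\<forall>j\<in>I. (\<Sum>i\<in>I. \<sigma> i j) \<le> n j) \<and>
      a * (sum p I + sum n I - 2 * (\<Sum>i\<in>I. \<Sum>j\<in>I. \<sigma> i j)) + b * (\<Sum>i\<in>I. \<Sum>j\<in>I. \<sigma> i j * d i j)
       \<le> a * (\<Sum>i\<in>I. \<bar>p i - n i - ((\<Sum>j\<in>I. \<rho> i j) - (\<Sum>j\<in>I. \<rho> j i))\<bar>)
         + b * (\<Sum>i\<in>I. \<Sum>j\<in>I. \<rho> i j * d i j)"
proof -
  define e where "e i = p i - n i - ((\<Sum>j\<in>I. \<rho> i j) - (\<Sum>j\<in>I. \<rho> j i))" for i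
  \<comment> \<open>A vertex that emits too much (\<open>e i < 0\<close>) gets extra supply, one
    that emits too little gets extra demand. Then \<open>p' - n'\<close> is the true divergence and
    the total enlargement is the sum of the \<open>\<bar>e i\<bar>\<close>.\<close>
  define p' where "p' i = p i + max 0 (- e i)" for i
  define n' where "n' i = n i + max 0 (e i)" for i
  have p'n': "0 \<le> p' i" "0 \<le> n' i" "p i \<le> p' i" "n i \<le> n' i" if "i \<in> I" for i
    using that pn by (auto simp: p'_def n'_def)
  have div: "(\<Sum>j\<in>I. \<rho> i j) - (\<Sum>j\<in>I. \<rho> j i) = p' i - n' i" for i
    by (simp add: p'_def n'_def e_def max_def)
  obtain \<tau> where \<tau>: "\<And>i j. i \<in> I \<Longrightarrow> j \<in> I \<Longrightarrow> 0 \<le> \<tau> i j"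
    "\<And>i. i \<in> I \<Longrightarrow> (\<Sum>j\<in>I. \<tau> i j) = p' i"
    "\<And>j. j \<in> I \<Longrightarrow> (\<Sum>i\<in>I. \<tau> i j) = n' j"
    "(\<Sum>i\<in>I. \<Sum>j\<in>I. \<tau> i j * d i j) \<le> (\<Sum>i\<in>I. \<Sum>j\<in>I. \<rho> i j * d i j)"
    using flow_to_transport[where d = d, OF fin nonneg p'n'(1,2) div d] by blast
  \<comment> \<open>Where \<open>p' i = 0\<close> the quotient is \<open>0\<close> by convention,
    which is right since then \<open>p i = 0\<close> too.\<close>
  define \<alpha> where "\<alpha> i = p i / p' i" for i
  define \<beta> where "\<beta> i = n i / n' i" for i
  have \<alpha>: "0 \<le> \<alpha> i" "\<alpha> i \<le> 1" "p' i * \<alpha> i = p i" if "i \<in> I" for i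
    using p'n'[OF that] pn(1)[OF that] by (auto simp: \<alpha>_def divide_le_eq_1)
  have \<beta>: "0 \<le> \<beta> i" "\<beta> i \<le> 1" "n' i * \<beta> i = n i" if "i \<in> I" for i
    using p'n'[OF that] pn(2)[OF that] by (auto simp: \<beta>_def divide_le_eq_1)
  define \<sigma> where "\<sigma> i j = \<tau> i j * (\<alpha> i * \<beta> j)" for i j
  have \<sigma>_le: "\<sigma> i j \<le> \<tau> i j * \<alpha> i" "\<sigma> i j \<le> \<tau> i j * \<beta> j" "\<sigma> i j \<le> \<tau> i j"
      "\<tau> i j * \<alpha> i + \<tau> i j * \<beta> j - \<tau> i j \<le> \<sigma> i j" "0 \<le> \<sigma> i j"
    if ij: "i \<in> I" "j \<in> I" for i j
  proof -
    have le: "\<alpha> i * \<beta> j \<le> \<alpha> i" "\<alpha> i * \<beta> j \<le> \<beta> j" "\<alpha> i * \<beta> j \<le> 1"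
      using \<alpha>[OF ij(1)] \<beta>[OF ij(2)] by (auto intro: mult_left_le mult_left_le_one_le mult_le_one)
    have "0 \<le> (1 - \<alpha> i) * (1 - \<beta> j)" using \<alpha>[OF ij(1)] \<beta>[OF ij(2)] by simp
    \<comment> \<open>The fraction not surviving is at most
      \<open>(1 - \<alpha> i) + (1 - \<beta> j)\<close>. Summed against \<open>\<tau>\<close>, this
      bounds the mass of \<open>\<sigma>\<close> from below by \<open>sum p I + sum n I\<close>
      minus the mass of \<open>\<tau>\<close>.\<close>
    then have ge: "\<alpha> i + \<beta> j - 1 \<le> \<alpha> i * \<beta> j" by (simp add: algebra_simps)
    show "\<sigma> i j \<le> \<tau> i j * \<alpha> i" "\<sigma> i j \<le> \<tau> i j * \<beta> j" "\<sigma> i j \<le> \<tau> i j"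
      using mult_left_mono[OF le(1) \<tau>(1)[OF ij]] mult_left_mono[OF le(2) \<tau>(1)[OF ij]]
        mult_left_mono[OF le(3) \<tau>(1)[OF ij]] by (simp_all add: \<sigma>_def)
    show "\<tau> i j * \<alpha> i + \<tau> i j * \<beta> j - \<tau> i j \<le> \<sigma> i j"
      using mult_left_mono[OF ge \<tau>(1)[OF ij]] by (simp add: \<sigma>_def algebra_simps)
    show "0 \<le> \<sigma> i j" using \<tau>(1)[OF ij] \<alpha>(1)[OF ij(1)] \<beta>(1)[OF ij(2)] by (simp add: \<sigma>_def)
  qed
  have \<tau>\<alpha>: "(\<Sum>j\<in>I. \<tau> i j * \<alpha> i) = p i" if "i \<in> I" for i
    using \<tau>(2)[OF that] \<alpha>(3)[OF that] by (simp flip: sum_distrib_right)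
  have \<tau>\<beta>: "(\<Sum>i\<in>I. \<tau> i j * \<beta> j) = n j" if "j \<in> I" for j
    using \<tau>(3)[OF that] \<beta>(3)[OF that] by (simp flip: sum_distrib_right)
  show ?thesis
  proof (intro exI[of _ \<sigma>] conjI ballI impI)
    show "(\<Sum>j\<in>I. \<sigma> i j) \<le> p i" if "i \<in> I" for i
      using \<tau>\<alpha>[OF that] sum_mono[of I "\<sigma> i" "\<lambda>j. \<tau> i j * \<alpha> i"] \<sigma>_le(1)[OF that] by simp
    show "(\<Sum>i\<in>I. \<sigma> i j) \<le> n j" if "j \<in> I" for j
      using \<tau>\<beta>[OF that] sum_mono[of I "\<lambda>i. \<sigma> i j" "\<lambda>i. \<tau> i j * \<beta> j"] \<sigma>_le(2)[OF _ that] by simp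
    have "(\<Sum>i\<in>I. \<Sum>j\<in>I. \<tau> i j * \<alpha> i + \<tau> i j * \<beta> j - \<tau> i j) \<le> (\<Sum>i\<in>I. \<Sum>j\<in>I. \<sigma> i j)"
      using \<sigma>_le(4) by (intro sum_mono) auto
    moreover have "(\<Sum>i\<in>I. \<Sum>j\<in>I. \<tau> i j * \<alpha> i + \<tau> i j * \<beta> j - \<tau> i j)
        = sum p I + sum n I - (\<Sum>i\<in>I. \<Sum>j\<in>I. \<tau> i j)"
    proof -
      have "(\<Sum>i\<in>I. \<Sum>j\<in>I. \<tau> i j * \<beta> j) = sum n I"
        by (subst sum.swap) (simp add: \<tau>\<beta>)
      then show ?thesis by (simp add: sum.distrib sum_subtractf \<tau>\<alpha>)
    qed
    moreover have "(\<Sum>i\<in>I. \<Sum>j\<in>I. \<tau> i j) = sum p' I" by (simp add: \<tau>(2))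
    moreover have "(\<Sum>i\<in>I. \<Sum>j\<in>I. \<tau> i j) = sum n' I" by (subst sum.swap) (simp add: \<tau>(3))
    \<comment> \<open>The mass of \<open>\<tau>\<close> equals both \<open>sum p' I\<close> and
      \<open>sum n' I\<close>; replacing twice this mass by their sum lets the two enlargements
      appear.\<close>
    ultimately have "sum p I + sum n I - 2 * (\<Sum>i\<in>I. \<Sum>j\<in>I. \<sigma> i j)
        \<le> sum p' I + sum n' I - sum p I - sum n I"
      by linarith
    also have "\<dots> = (\<Sum>i\<in>I. \<bar>e i\<bar>)"
      by (simp add: p'_def n'_def sum.distrib max_def flip: sum_subtractf)
         (simp flip: sum.distrib, intro sum.cong, auto)
    finally have 1: "a * (sum p I + sum n I - 2 * (\<Sum>i\<in>I. \<Sum>j\<in>I. \<sigma> i j)) \<le> a * (\<Sum>i\<in>I. \<bar>e i\<bar>)"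
      using ab by (intro mult_left_mono)
    have "(\<Sum>i\<in>I. \<Sum>j\<in>I. \<sigma> i j * d i j) \<le> (\<Sum>i\<in>I. \<Sum>j\<in>I. \<tau> i j * d i j)"
      using \<sigma>_le(3) d(1) by (intro sum_mono mult_right_mono) auto
    then have 2: "b * (\<Sum>i\<in>I. \<Sum>j\<in>I. \<sigma> i j * d i j) \<le> b * (\<Sum>i\<in>I. \<Sum>j\<in>I. \<rho> i j * d i j)"
      using \<tau>(4) ab by (intro mult_left_mono) auto
    show "a * (sum p I + sum n I - 2 * (\<Sum>i\<in>I. \<Sum>j\<in>I. \<sigma> i j)) + b * (\<Sum>i\<in>I. \<Sum>j\<in>I. \<sigma> i j * d i j)
       \<le> a * (\<Sum>i\<in>I. \<bar>p i - n i - ((\<Sum>j\<in>I. \<rho> i j) - (\<Sum>j\<in>I. \<rho> j i))\<bar>)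
         + b * (\<Sum>i\<in>I. \<Sum>j\<in>I. \<rho> i j * d i j)"
      using 1 2 by (simp add: e_def)
  qed (use \<sigma>_le in auto)
qed

section \<open>Cells, total variation and competitors\<close>

lemma exists_cells:
  fixes R h :: real
  assumes "h > 0"
  shows "\<exists>(I :: nat set) Q (c :: nat \<Rightarrow> 'a::euclidean_space). finite I \<and> disjoint_family_on Q I \<and>
    (\<forall>i\<in>I. Q i \<in> sets borel \<and> Q i \<subseteq> ball (c i) h) \<and> (\<Union>i\<in>I. Q i) = cball 0 R"
proof -
  have "compact (cball (0::'a) R)" by simp
  then obtain C where C: "finite C" "cball (0::'a) R \<subseteq> (\<Union>x\<in>C. ball x h)"
    using \<open>h > 0\<close> unfolding compact_eq_totally_bounded by blast
  obtain c :: "nat \<Rightarrow> 'a" and m where c: "C = c ` {..<m}"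
    using C(1) by (metis finite_imp_nat_seg_image_inj_on lessThan_def)
  define B where "B i = cball 0 R \<inter> ball (c i) h" for i
  have B: "B i \<in> sets borel" for i by (simp add: B_def)
  show ?thesis
  proof (intro exI[of _ "{..<m}"] exI[of _ "disjointed B"] exI[of _ c] conjI ballI)
    show "disjoint_family_on (disjointed B) {..<m}"
      using disjoint_family_disjointed[of B] by (auto simp: disjoint_family_on_def)
    show "disjointed B i \<in> sets borel" for i
      using B by (auto simp: disjointed_def)
    show "disjointed B i \<subseteq> ball (c i) h" for i
      using disjointed_subset[of B i] by (auto simp: B_def)
    have "(\<Union>i<m. disjointed B i) = (\<Union>i<m. B i)"
      using finite_UN_disjointed_eq[of B m] by (simp add: atLeast0LessThan)
    also have "\<dots> = cball 0 R" using C(2) by (auto simp: B_def c)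
    finally show "(\<Union>i<m. disjointed B i) = cball 0 R" .
  qed simp
qed

lemma sum_abs_le_total_variation:
  assumes "finite I" "disjoint_family_on Q I" "\<And>i. i \<in> I \<Longrightarrow> Q i \<in> sets borel" "\<nu> {} = 0"
  shows "ennreal (\<Sum>i\<in>I. \<bar>\<nu> (Q i)\<bar>) \<le> total_variation \<nu>"
proof -
  \<comment> \<open>\<open>partition_on\<close> forbids empty blocks, and only on nonempty cells
    does disjointness make \<open>Q\<close> injective. The complement \<open>rest\<close> completes
    the cells to a partition of the whole space.\<close>
  define J where "J = {i\<in>I. Q i \<noteq> {}}"
  define rest where "rest = - (\<Union>i\<in>I. Q i)"
  define F where "F = Q ` J \<union> ({rest} - {{}})"
  have J: "finite J" "J \<subseteq> I" using assms(1) by (auto simp: J_def)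
  have F: "finite F" using J by (simp add: F_def)
  have "(\<Union>i\<in>I. Q i) \<in> sets borel" using assms(1,3) by blast
  then have "rest \<in> sets borel" unfolding rest_def by (rule borel_comp)
  then have "F \<subseteq> sets borel"
    using assms(3) J by (auto simp: F_def)
  moreover have "partition_on UNIV F"
  proof (rule partition_onI)
    show "disjnt p q" if pq: "p \<in> F" "q \<in> F" "p \<noteq> q" for p q
    proof -
      have D: "disjnt (Q i) (Q j)" if "i \<in> J" "j \<in> J" "Q i \<noteq> Q j" for i j
      proof -
        have "i \<noteq> j" using that by auto
        then show ?thesis
          using that J(2) assms(2) by (auto simp: disjoint_family_on_def disjnt_def)
      qed
      have D': "disjnt (Q i) rest" "disjnt rest (Q i)" if "i \<in> J" for i
        using that J(2) by (auto simp: disjnt_def rest_def)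
      have cases: "(\<exists>i\<in>J. r = Q i) \<or> r = rest" if "r \<in> F" for r
        using that by (auto simp: F_def)
      show ?thesis
        using cases[OF pq(1)] cases[OF pq(2)] pq(3) by (auto intro: D D')
    qed
    show "\<Union>F = UNIV"
    proof -
      have "x \<in> \<Union>F" for x
      proof (cases "\<exists>i\<in>I. x \<in> Q i")
        case True
        then show ?thesis by (auto simp: F_def J_def)
      next
        case False
        then have "x \<in> rest" by (simp add: rest_def)
        moreover from this have "rest \<in> F" by (auto simp: F_def)
        ultimately show ?thesis by blast
      qed
      then show ?thesis by blast
    qed
    show "{} \<notin> F" by (auto simp: F_def J_def)
  qed
  ultimately have "ennreal (\<Sum>A\<in>F. \<bar>\<nu> A\<bar>) \<le> total_variation \<nu>"
    unfolding total_variation_def using F by (intro SUP_upper) auto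
  moreover have "(\<Sum>i\<in>I. \<bar>\<nu> (Q i)\<bar>) = (\<Sum>i\<in>J. \<bar>\<nu> (Q i)\<bar>)"
    using assms(1,4) by (intro sum.mono_neutral_right) (auto simp: J_def)
  moreover have "inj_on Q J"
  proof (rule inj_onI)
    fix i j assume ij: "i \<in> J" "j \<in> J" "Q i = Q j"
    then have "Q i \<inter> Q j \<noteq> {}" "i \<in> I" "j \<in> I" by (auto simp: J_def)
    then show "i = j" using assms(2) unfolding disjoint_family_on_def by metis
  qed
  then have "(\<Sum>i\<in>J. \<bar>\<nu> (Q i)\<bar>) = (\<Sum>A\<in>Q ` J. \<bar>\<nu> A\<bar>)"
    by (simp add: sum.reindex)
  moreover have "\<dots> \<le> (\<Sum>A\<in>F. \<bar>\<nu> A\<bar>)"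
    using F by (intro sum_mono2) (auto simp: F_def)
  ultimately show ?thesis by (metis ennreal_leI order_trans)
qed

text \<open>The difference of nested measures is itself positive, so every partition gives the same
  sum. A competitor lying below the given measure thus pays only for the mass it omits.\<close>

lemma total_variation_diff_le:
  fixes M M' :: "'a::euclidean_space measure"
  assumes M: "M \<in> fin_borel_measures" "M' \<in> fin_borel_measures"
    and le: "\<And>A. A \<in> sets borel \<Longrightarrow> measure M' A \<le> measure M A"
  shows "total_variation (\<lambda>A. measure M A - measure M' A) \<le> ennreal (measure M UNIV - measure M' UNIV)"
  unfolding total_variation_def
proof (rule SUP_least)
  fix F :: "'a set set" assume "F \<in> {F. finite F \<and> F \<subseteq> sets borel \<and> partition_on UNIV F}"
  then have F: "finite F" "F \<subseteq> sets borel" "partition_on UNIV F" by auto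
  have *: "(\<Sum>A\<in>F. measure L A) = measure L UNIV" if "L \<in> fin_borel_measures" for L :: "'a measure"
  proof -
    interpret finite_measure L using that by (simp add: fin_borel_measures_def)
    have "(\<Sum>A\<in>F. measure L A) = measure L (\<Union>A\<in>F. A)"
      using F that
      by (intro finite_measure_finite_Union[symmetric])
        (auto simp: partition_on_def disjoint_family_on_def disjoint_def fin_borel_measures_def)
    also have "(\<Union>A\<in>F. A) = UNIV" using F by (simp add: partition_on_def)
    finally show ?thesis .
  qed
  have "(\<Sum>A\<in>F. \<bar>measure M A - measure M' A\<bar>) = (\<Sum>A\<in>F. measure M A - measure M' A)"
    using le F by (intro sum.cong) auto
  also have "\<dots> = measure M UNIV - measure M' UNIV" using * M by (simp add: sum_subtractf)
  finally show "ennreal (\<Sum>A\<in>F. \<bar>measure M A - measure M' A\<bar>) \<le> ennreal (measure M UNIV - measure M' UNIV)"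
    by simp
qed

lemma W1ab_commute: "W1ab a b M N = W1ab a b N M"
proof -
  have le: "W1 N M \<le> W1 M N" for M N :: "'a measure"
    unfolding W1_def
  proof (rule INF_mono)
    fix \<pi> assume "\<pi> \<in> couplings M N"
    then have [measurable_cong]: "sets \<pi> = sets (borel \<Otimes>\<^sub>M borel)"
      and m: "distr \<pi> borel fst = M" "distr \<pi> borel snd = N" by (auto simp: couplings_def)
    let ?\<pi> = "distr \<pi> (borel \<Otimes>\<^sub>M borel) (\<lambda>(x, y). (y, x))"
    have "distr ?\<pi> borel fst = distr \<pi> borel snd" "distr ?\<pi> borel snd = distr \<pi> borel fst"
      by (subst distr_distr; auto intro!: arg_cong[of _ _ "distr \<pi> borel"])+
    then have "?\<pi> \<in> couplings N M" using m by (simp add: couplings_def)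
    moreover have "(\<integral>\<^sup>+ (x, y). ennreal (dist x y) \<partial>?\<pi>) = (\<integral>\<^sup>+ (x, y). ennreal (dist x y) \<partial>\<pi>)"
      by (subst nn_integral_distr) (auto simp: dist_commute intro!: nn_integral_cong)
    ultimately show "\<exists>\<pi>'\<in>couplings N M. (\<integral>\<^sup>+ (x, y). ennreal (dist x y) \<partial>\<pi>') \<le> (\<integral>\<^sup>+ (x, y). ennreal (dist x y) \<partial>\<pi>)"
      by (metis order_refl)
  qed
  then have W1: "W1 M N = W1 N M" for M N :: "'a measure" by (intro antisym)
  have "W1ab a b N M \<le> W1ab a b M N" for M N :: "'a measure"
    unfolding W1ab_def
  proof (rule INF_mono, clarify)
    fix M' N' :: "'a measure"
    assume "M' \<in> fin_borel_measures" "N' \<in> fin_borel_measures" "emeasure M' UNIV = emeasure N' UNIV"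
    then show "\<exists>m\<in>{(N', M'). N' \<in> fin_borel_measures \<and> M' \<in> fin_borel_measures \<and>
                         emeasure N' UNIV = emeasure M' UNIV}.
        (case m of (N', M') \<Rightarrow> ennreal a * (total_variation (\<lambda>A. measure N A - measure N' A)
                   + total_variation (\<lambda>A. measure M A - measure M' A)) + ennreal b * W1 N' M')
        \<le> ennreal a * (total_variation (\<lambda>A. measure M A - measure M' A)
                   + total_variation (\<lambda>A. measure N A - measure N' A)) + ennreal b * W1 M' N'"
      by (intro bexI[of _ "(N', M')"]) (simp_all add: W1[of N'] add.commute)
  qed
  then show ?thesis by (intro antisym)
qed

text \<open>Both nested infima are opened at once and the extended values replaced by reals: the
  strict inequality leaves a positive budget after the removal cost, which an actual coupling can
  meet.\<close>

lemma W1ab_less_obtains: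
  fixes M N :: "'a::euclidean_space measure"
  assumes b: "0 < b" and a: "0 \<le> a" and less: "W1ab a b M N < ennreal c"
  obtains M' N' \<pi> t u where "M' \<in> fin_borel_measures" "N' \<in> fin_borel_measures" "\<pi> \<in> couplings M' N'"
    "0 \<le> t" "ennreal a * (total_variation (\<lambda>A. measure M A - measure M' A)
                   + total_variation (\<lambda>A. measure N A - measure N' A)) = ennreal t"
    "0 \<le> u" "(\<integral>\<^sup>+ (x, y). ennreal (dist x y) \<partial>\<pi>) = ennreal u" "t + b * u < c"
proof -
  from less obtain M' N' where *: "M' \<in> fin_borel_measures" "N' \<in> fin_borel_measures"
    "ennreal a * (total_variation (\<lambda>A. measure M A - measure M' A)
                   + total_variation (\<lambda>A. measure N A - measure N' A))
        + ennreal b * W1 M' N' < ennreal c" (is "?t + _ < _")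
    unfolding W1ab_def INF_less_iff by auto
  have fin: "?t + ennreal b * W1 M' N' < top" using order_less_trans[OF *(3) ennreal_less_top] by simp
  then have "?t < top" by (simp only: ennreal_add_less_top)
  then obtain t where t: "0 \<le> t" "?t = ennreal t" unfolding less_top_ennreal by blast
  \<comment> \<open>This needs \<open>0 < b\<close>: with factor \<open>0\<close> the product would
    hide an infinite distance.\<close>
  have "W1 M' N' < top" using fin b by (auto simp: ennreal_mult_less_top)
  then obtain w where w: "0 \<le> w" "W1 M' N' = ennreal w" by (auto simp: less_top_ennreal)
  have "t + b * w < c"
    using *(3) b w unfolding t(2) w(2)
    by (simp add: ennreal_less_iff t(1) flip: ennreal_mult ennreal_plus)
  then have "w < (c - t) / b" using b by (simp add: pos_less_divide_eq algebra_simps)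
  then have "W1 M' N' < ennreal ((c - t) / b)" using w by (simp add: ennreal_less_iff)
  then obtain \<pi> where \<pi>: "\<pi> \<in> couplings M' N'"
    "(\<integral>\<^sup>+ (x, y). ennreal (dist x y) \<partial>\<pi>) < ennreal ((c - t) / b)"
    unfolding W1_def INF_less_iff by auto
  obtain u where u: "0 \<le> u" "(\<integral>\<^sup>+ (x, y). ennreal (dist x y) \<partial>\<pi>) = ennreal u"
    using order_less_trans[OF \<pi>(2) ennreal_less_top] unfolding less_top_ennreal by blast
  have "t + b * u < c"
    using \<pi>(2) u b by (simp add: ennreal_less_iff pos_less_divide_eq algebra_simps)
  then show thesis using that[OF *(1,2) \<pi>(1) t u] by simp
qed

lemma fin_borel_measuresD:
  assumes "M \<in> fin_borel_measures"
  shows "sets M = sets borel" "finite_measure M" "space M = UNIV"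
proof -
  show "sets M = sets borel" "finite_measure M" using assms by (simp_all add: fin_borel_measures_def)
  then show "space M = UNIV" using sets_eq_imp_space_eq[of M borel] by (simp only: space_borel)
qed

lemma measure_outside_cball_tendsto_0:
  fixes M :: "'a::euclidean_space measure"
  assumes "M \<in> fin_borel_measures"
  shows "(\<lambda>k. measure M (- cball 0 (real k))) \<longlonglongrightarrow> 0"
proof -
  let ?A = "\<lambda>k::nat. - cball (0::'a) (real k)"
  have "range ?A \<subseteq> sets M"
    unfolding fin_borel_measuresD(1)[OF assms] by (intro image_subsetI borel_comp borel_closed closed_cball)
  moreover have "decseq ?A"
    unfolding decseq_def by (intro allI impI Compl_anti_mono subset_cball) simp
  ultimately have "(\<lambda>k. measure M (?A k)) \<longlonglongrightarrow> measure M (\<Inter>k. ?A k)"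
    by (rule finite_measure.finite_Lim_measure_decseq[OF fin_borel_measuresD(2)[OF assms]])
  moreover have "(\<Inter>k. ?A k) = {}"
  proof -
    have "\<exists>k. x \<in> cball 0 (real k)" for x :: 'a
      using real_arch_simple[of "norm x"] by (simp only: mem_cball dist_0_norm)
    then show ?thesis by blast
  qed
  ultimately show ?thesis by simp
qed

section \<open>Step densities\<close>

lemma sum_indicator_le:
  fixes f :: "'i \<Rightarrow> ennreal"
  assumes "finite K" "disjoint_family_on E K" "\<And>i. i \<in> K \<Longrightarrow> z \<in> E i \<Longrightarrow> f i \<le> C"
  shows "(\<Sum>i\<in>K. f i * indicator (E i) z) \<le> C"
proof (cases "\<exists>i\<in>K. z \<in> E i")
  case True
  then obtain i where i: "i \<in> K" "z \<in> E i" by auto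
  then have "z \<notin> E j" if "j \<in> K - {i}" for j
    using that assms(2) by (auto simp: disjoint_family_on_def)
  then have "(\<Sum>j\<in>K. f j * indicator (E j) z) = f i * indicator (E i) z"
    using i assms(1) by (subst sum.remove[of K i]) (auto intro!: sum.neutral)
  then show ?thesis using i assms(3) by simp
next
  case False
  then have "(\<Sum>i\<in>K. f i * indicator (E i) z) = 0" by (intro sum.neutral) auto
  then show ?thesis by simp
qed

text \<open>
  A plan is a density with respect to the product measure, whose two marginals are dominated by
  \<open>P\<close> and \<open>N\<close>; the undominated rest is paid for as removed mass. Truncated subtraction in
  \<^typ>\<open>ennreal\<close> is harmless because both marginal densities are at most \<open>1\<close>.
\<close>

definition is_plan :: "'a::euclidean_space measure \<Rightarrow> 'a measure \<Rightarrow> ('a \<Rightarrow> 'a \<Rightarrow> ennreal) \<Rightarrow> bool" where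
  "is_plan P N w \<longleftrightarrow> case_prod w \<in> borel_measurable (borel \<Otimes>\<^sub>M borel) \<and>
     (\<forall>x. (\<integral>\<^sup>+ y. w x y \<partial>N) \<le> 1) \<and> (\<forall>y. (\<integral>\<^sup>+ x. w x y \<partial>P) \<le> 1)"

definition plan_cost ::
    "real \<Rightarrow> real \<Rightarrow> 'a::euclidean_space measure \<Rightarrow> 'a measure \<Rightarrow> ('a \<Rightarrow> 'a \<Rightarrow> ennreal) \<Rightarrow> ennreal" where
  "plan_cost a b P N w =
     ennreal a * ((\<integral>\<^sup>+ x. 1 - (\<integral>\<^sup>+ y. w x y \<partial>N) \<partial>P) + (\<integral>\<^sup>+ y. 1 - (\<integral>\<^sup>+ x. w x y \<partial>P) \<partial>N))
     + ennreal b * (\<integral>\<^sup>+ x. \<integral>\<^sup>+ y. w x y * ennreal (dist x y) \<partial>N \<partial>P)"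

text \<open>Mass \<open>\<sigma> i j\<close> is spread over \<open>Q i \<times> Q j\<close> in
  proportion to the product measure. On cells of measure zero the quotient is \<open>0\<close>,
  consistently, since the marginal bounds imposed below force \<open>\<sigma> i j = 0\<close>
  there.\<close>

definition step_density ::
    "'i set \<Rightarrow> ('i \<Rightarrow> 'a set) \<Rightarrow> ('i \<Rightarrow> 'i \<Rightarrow> real) \<Rightarrow> 'a measure \<Rightarrow> 'a measure \<Rightarrow> 'a \<Rightarrow> 'a \<Rightarrow> ennreal" where
  "step_density I Q \<sigma> P N x y = (\<Sum>i\<in>I. \<Sum>j\<in>I.
     ennreal (\<sigma> i j / (measure P (Q i) * measure N (Q j))) * (indicator (Q i) x * indicator (Q j) y))"

text \<open>Transposition reduces each statement on the second marginal to one on the first.\<close>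

lemma step_density_swap:
  "step_density I Q \<sigma> P N x y = step_density I Q (\<lambda>i j. \<sigma> j i) N P y x"
  unfolding step_density_def by (subst sum.swap) (simp add: mult_ac)

context
  fixes I :: "'i set" and Q :: "'i \<Rightarrow> 'a::euclidean_space set" and P N :: "'a measure"
    and \<sigma> :: "'i \<Rightarrow> 'i \<Rightarrow> real"
  assumes fin: "finite I" and disj: "disjoint_family_on Q I"
    and Q: "\<And>i. i \<in> I \<Longrightarrow> Q i \<in> sets borel"
    and P: "P \<in> fin_borel_measures" and N: "N \<in> fin_borel_measures"
    and nonneg: "\<And>i j. i \<in> I \<Longrightarrow> j \<in> I \<Longrightarrow> 0 \<le> \<sigma> i j"
    and row: "\<And>i. i \<in> I \<Longrightarrow> (\<Sum>j\<in>I. \<sigma> i j) \<le> measure P (Q i)"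
    and col: "\<And>j. j \<in> I \<Longrightarrow> (\<Sum>i\<in>I. \<sigma> i j) \<le> measure N (Q j)"
begin

lemma measurable_step_density: "case_prod (step_density I Q \<sigma> P N) \<in> borel_measurable (borel \<Otimes>\<^sub>M borel)"
proof -
  have [measurable]: "i \<in> I \<Longrightarrow> Q i \<in> sets borel" for i by (rule Q)
  show ?thesis unfolding step_density_def case_prod_beta by measurable
qed

text \<open>Cancelling the measure of a cell is legitimate even if it is zero: the row and column
  bounds make \<open>\<sigma> i j\<close> at most either cell measure, so both sides then
  vanish.\<close>

lemma step_density_vanish:
  assumes "i \<in> I" "j \<in> I"
  shows "\<sigma> i j / (measure P (Q i) * measure N (Q j)) * measure N (Q j) = \<sigma> i j / measure P (Q i)"
    and "\<sigma> i j / measure P (Q i) * measure P (Q i) = \<sigma> i j"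
proof -
  have le: "\<sigma> i j \<le> measure P (Q i)" "\<sigma> i j \<le> measure N (Q j)"
    using member_le_sum[of j I "\<sigma> i"] row[of i] member_le_sum[of i I "\<lambda>i. \<sigma> i j"] col[of j] nonneg fin assms
    by force+
  show "\<sigma> i j / (measure P (Q i) * measure N (Q j)) * measure N (Q j) = \<sigma> i j / measure P (Q i)"
    using le nonneg[OF assms] by (cases "measure N (Q j) = 0") auto
  show "\<sigma> i j / measure P (Q i) * measure P (Q i) = \<sigma> i j"
    using le nonneg[OF assms] by (cases "measure P (Q i) = 0") auto
qed

lemma emeasure_cells: "i \<in> I \<Longrightarrow> emeasure P (Q i) = ennreal (measure P (Q i))"
    "i \<in> I \<Longrightarrow> emeasure N (Q i) = ennreal (measure N (Q i))"
  using finite_measure.emeasure_eq_measure[OF fin_borel_measuresD(2)] P N by auto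

lemma nn_integral_step_density:
  "(\<integral>\<^sup>+ y. step_density I Q \<sigma> P N x y \<partial>N)
     = (\<Sum>i\<in>I. ennreal ((\<Sum>j\<in>I. \<sigma> i j) / measure P (Q i)) * indicator (Q i) x)"
proof -
  have [measurable]: "i \<in> I \<Longrightarrow> Q i \<in> sets N" for i
    using Q fin_borel_measuresD(1)[OF N] by simp
  have "(\<integral>\<^sup>+ y. step_density I Q \<sigma> P N x y \<partial>N) = (\<Sum>i\<in>I. \<Sum>j\<in>I.
     (ennreal (\<sigma> i j / (measure P (Q i) * measure N (Q j))) * indicator (Q i) x) * emeasure N (Q j))"
    unfolding step_density_def mult.assoc[symmetric]
    by (simp add: nn_integral_sum nn_integral_cmult_indicator)
  also have "\<dots> = (\<Sum>i\<in>I. \<Sum>j\<in>I. ennreal (\<sigma> i j / measure P (Q i)) * indicator (Q i) x)"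
  proof (intro sum.cong refl)
    fix i j assume ij: "i \<in> I" "j \<in> I"
    have "ennreal (\<sigma> i j / (measure P (Q i) * measure N (Q j))) * emeasure N (Q j) = ennreal (\<sigma> i j / measure P (Q i))"
      unfolding emeasure_cells(2)[OF ij(2)]
      by (subst ennreal_mult[symmetric]) (use ij nonneg step_density_vanish(1) in \<open>auto simp del: times_divide_eq_left\<close>)
    then show "ennreal (\<sigma> i j / (measure P (Q i) * measure N (Q j))) * indicator (Q i) x * emeasure N (Q j)
        = ennreal (\<sigma> i j / measure P (Q i)) * indicator (Q i) x"
      by (metis mult.assoc mult.commute)
  qed
  also have "\<dots> = (\<Sum>i\<in>I. ennreal ((\<Sum>j\<in>I. \<sigma> i j) / measure P (Q i)) * indicator (Q i) x)"
    using nonneg by (intro sum.cong refl) (simp add: sum_divide_distrib sum_ennreal flip: sum_distrib_right)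
  finally show ?thesis .
qed

lemma nn_integral_step_density_le_1: "(\<integral>\<^sup>+ y. step_density I Q \<sigma> P N x y \<partial>N) \<le> 1"
  unfolding nn_integral_step_density
proof (rule sum_indicator_le[OF fin disj])
  fix i assume "i \<in> I"
  then have "(\<Sum>j\<in>I. \<sigma> i j) / measure P (Q i) \<le> 1" using row[of i] by (auto simp: divide_le_eq_1 less_le)
  then show "ennreal ((\<Sum>j\<in>I. \<sigma> i j) / measure P (Q i)) \<le> 1" by simp
qed

lemma nn_integral_residual_step_density:
  "(\<integral>\<^sup>+ x. 1 - (\<integral>\<^sup>+ y. step_density I Q \<sigma> P N x y \<partial>N) \<partial>P)
     = ennreal (measure P UNIV - (\<Sum>i\<in>I. \<Sum>j\<in>I. \<sigma> i j))"
proof -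
  have [measurable]: "i \<in> I \<Longrightarrow> Q i \<in> sets P" for i
    using Q fin_borel_measuresD(1)[OF P] by simp
  let ?f = "\<lambda>x. \<Sum>i\<in>I. ennreal ((\<Sum>j\<in>I. \<sigma> i j) / measure P (Q i)) * indicator (Q i) x"
  have "(\<integral>\<^sup>+ x. ?f x \<partial>P) = (\<Sum>i\<in>I. ennreal ((\<Sum>j\<in>I. \<sigma> i j) / measure P (Q i)) * emeasure P (Q i))"
    by (simp add: nn_integral_sum nn_integral_cmult_indicator)
  also have "\<dots> = (\<Sum>i\<in>I. ennreal (\<Sum>j\<in>I. \<sigma> i j))"
  proof (intro sum.cong refl)
    fix i assume i: "i \<in> I"
    have "(\<Sum>j\<in>I. \<sigma> i j) / measure P (Q i) * measure P (Q i) = (\<Sum>j\<in>I. \<sigma> i j)"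
      unfolding sum_divide_distrib sum_distrib_right
      using i step_density_vanish(2) by (intro sum.cong refl) blast
    then show "ennreal ((\<Sum>j\<in>I. \<sigma> i j) / measure P (Q i)) * emeasure P (Q i) = ennreal (\<Sum>j\<in>I. \<sigma> i j)"
      unfolding emeasure_cells(1)[OF i]
      by (subst ennreal_mult[symmetric]) (use i nonneg in \<open>auto intro!: sum_nonneg divide_nonneg_nonneg\<close>)
  qed
  also have "\<dots> = ennreal (\<Sum>i\<in>I. \<Sum>j\<in>I. \<sigma> i j)"
    using nonneg by (intro sum_ennreal sum_nonneg) auto
  finally have int: "(\<integral>\<^sup>+ x. ?f x \<partial>P) = ennreal (\<Sum>i\<in>I. \<Sum>j\<in>I. \<sigma> i j)" .
  have "(\<integral>\<^sup>+ x. 1 - ?f x \<partial>P) = (\<integral>\<^sup>+ x. 1 \<partial>P) - (\<integral>\<^sup>+ x. ?f x \<partial>P)"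
    using int nn_integral_step_density_le_1
    by (intro nn_integral_diff) (auto simp: nn_integral_step_density)
  also have "(\<integral>\<^sup>+ x. 1 \<partial>P) = ennreal (measure P UNIV)"
    using fin_borel_measuresD[OF P] by (simp add: finite_measure.emeasure_eq_measure)
  also have "\<dots> - (\<integral>\<^sup>+ x. ?f x \<partial>P) = ennreal (measure P UNIV - (\<Sum>i\<in>I. \<Sum>j\<in>I. \<sigma> i j))"
    unfolding int using nonneg by (intro ennreal_minus sum_nonneg) auto
  finally show ?thesis by (simp add: nn_integral_step_density)
qed

lemma nn_integral_dist_step_density:
  assumes c: "\<And>i. i \<in> I \<Longrightarrow> Q i \<subseteq> ball (c i) h" and "0 \<le> h"
  shows "(\<integral>\<^sup>+ x. \<integral>\<^sup>+ y. step_density I Q \<sigma> P N x y * ennreal (dist x y) \<partial>N \<partial>P)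
    \<le> ennreal ((\<Sum>i\<in>I. \<Sum>j\<in>I. \<sigma> i j * dist (c i) (c j)) + 2 * h * (\<Sum>i\<in>I. \<Sum>j\<in>I. \<sigma> i j))"
proof -
  have [measurable]: "i \<in> I \<Longrightarrow> Q i \<in> sets P" "i \<in> I \<Longrightarrow> Q i \<in> sets N" for i
    using Q fin_borel_measuresD(1)[OF P] fin_borel_measuresD(1)[OF N] by auto
  let ?s = "\<lambda>i j. \<sigma> i j / (measure P (Q i) * measure N (Q j))"
  let ?d = "\<lambda>i j. dist (c i) (c j) + 2 * h"
  have "step_density I Q \<sigma> P N x y * ennreal (dist x y)
    \<le> (\<Sum>i\<in>I. \<Sum>j\<in>I. ennreal (?s i j * ?d i j) * indicator (Q i) x * indicator (Q j) y)" for x y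
    unfolding step_density_def sum_distrib_right
  proof (intro sum_mono)
    fix i j assume ij: "i \<in> I" "j \<in> I"
    show "ennreal (?s i j) * (indicator (Q i) x * indicator (Q j) y) * ennreal (dist x y)
      \<le> ennreal (?s i j * ?d i j) * indicator (Q i) x * indicator (Q j) y"
    proof (cases "x \<in> Q i \<and> y \<in> Q j")
      case True
      then have "dist (c i) x < h" "dist (c j) y < h"
        using subsetD[OF c[OF ij(1)], of x] subsetD[OF c[OF ij(2)], of y] by auto
      \<comment> \<open>Each point is within \<open>h\<close> of the centre of its cell, so the
        detour through both centres adds at most \<open>2 * h\<close>.\<close>
      then have "dist x y \<le> ?d i j"
        using dist_triangle[of x y "c i"] dist_triangle[of "c i" y "c j"] by (simp add: dist_commute)
      moreover have "0 \<le> ?s i j" using nonneg[OF ij] by simp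
      ultimately have "ennreal (?s i j * dist x y) \<le> ennreal (?s i j * ?d i j)"
        by (intro ennreal_leI mult_left_mono)
      then show ?thesis using True \<open>0 \<le> ?s i j\<close> by (simp only: ennreal_mult' indicator_simps mult_1_right)
    qed auto
  qed
  then have "(\<integral>\<^sup>+ x. \<integral>\<^sup>+ y. step_density I Q \<sigma> P N x y * ennreal (dist x y) \<partial>N \<partial>P)
    \<le> (\<integral>\<^sup>+ x. \<integral>\<^sup>+ y. (\<Sum>i\<in>I. \<Sum>j\<in>I. ennreal (?s i j * ?d i j) * indicator (Q i) x * indicator (Q j) y) \<partial>N \<partial>P)"
    by (intro nn_integral_mono)
  also have "\<dots> = (\<integral>\<^sup>+ x. (\<Sum>i\<in>I. \<Sum>j\<in>I. ennreal (?s i j * ?d i j) * indicator (Q i) x * emeasure N (Q j)) \<partial>P)"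
    by (simp add: nn_integral_sum nn_integral_cmult_indicator)
  also have "\<dots> = (\<Sum>i\<in>I. \<Sum>j\<in>I. ennreal (?s i j * ?d i j) * emeasure N (Q j) * emeasure P (Q i))"
    by (simp add: nn_integral_sum nn_integral_cmult_indicator mult.assoc mult.commute[of "indicator _ _"])
       (simp add: nn_integral_sum nn_integral_cmult_indicator flip: mult.assoc)
  also have "\<dots> = (\<Sum>i\<in>I. \<Sum>j\<in>I. ennreal (\<sigma> i j * ?d i j))"
  proof (intro sum.cong refl)
    fix i j assume ij: "i \<in> I" "j \<in> I"
    have "?s i j * ?d i j * measure N (Q j) * measure P (Q i) = ((?s i j * measure N (Q j)) * measure P (Q i)) * ?d i j"
      by (simp only: mult_ac)
    also have "\<dots> = \<sigma> i j * ?d i j" by (simp only: step_density_vanish[OF ij])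
    finally show "ennreal (?s i j * ?d i j) * emeasure N (Q j) * emeasure P (Q i) = ennreal (\<sigma> i j * ?d i j)"
      unfolding emeasure_cells(1)[OF ij(1)] emeasure_cells(2)[OF ij(2)]
      using nonneg[OF ij] \<open>0 \<le> h\<close> by (simp only: ennreal_mult'' measure_nonneg flip: ennreal_mult'')
  qed
  also have "\<dots> = ennreal (\<Sum>i\<in>I. \<Sum>j\<in>I. \<sigma> i j * ?d i j)"
    using nonneg \<open>0 \<le> h\<close> by (simp add: sum_ennreal sum_nonneg)
  also have "(\<Sum>i\<in>I. \<Sum>j\<in>I. \<sigma> i j * ?d i j)
      = (\<Sum>i\<in>I. \<Sum>j\<in>I. \<sigma> i j * dist (c i) (c j)) + 2 * h * (\<Sum>i\<in>I. \<Sum>j\<in>I. \<sigma> i j)"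
    by (simp add: distrib_left sum.distrib sum_distrib_left mult_ac)
  finally show ?thesis .
qed

end

section \<open>Discretisation\<close>

lemma ennreal_cost:
  assumes "0 \<le> a" "0 \<le> b" "0 \<le> x" "0 \<le> y" "0 \<le> z"
  shows "ennreal a * (ennreal x + ennreal y) + ennreal b * ennreal z = ennreal (a * (x + y) + b * z)"
  using assms by (simp add: ennreal_plus ennreal_mult)

text \<open>Level \<open>k\<close> refines two things together: the cells lie in balls of radius
  \<open>1 / (k + 1)\<close>, and they fill the ball of radius \<open>k\<close>. Mesh error and mass
  left outside thus vanish along a single index.\<close>

locale cell_grid =
  fixes I :: "nat \<Rightarrow> nat set" and Q :: "nat \<Rightarrow> nat \<Rightarrow> 'a::euclidean_space set" and c :: "nat \<Rightarrow> nat \<Rightarrow> 'a"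
  assumes finite_I: "finite (I k)"
    and disjoint_Q: "disjoint_family_on (Q k) (I k)"
    and borel_Q: "i \<in> I k \<Longrightarrow> Q k i \<in> sets borel"
    and Q_subset_ball: "i \<in> I k \<Longrightarrow> Q k i \<subseteq> ball (c k i) (1 / real (Suc k))"
    and UN_Q: "(\<Union>i\<in>I k. Q k i) = cball 0 (real k)"
begin

text \<open>The objective of a minimum-cost flow problem with slack: a divergence that misses the
  cell values of \<open>\<nu>\<close> is penalised at rate \<open>a\<close> instead of being
  forbidden.\<close>

definition flow_cost :: "real \<Rightarrow> real \<Rightarrow> nat \<Rightarrow> ('a set \<Rightarrow> real) \<Rightarrow> (nat \<Rightarrow> nat \<Rightarrow> real) \<Rightarrow> real" where
  "flow_cost a b k \<nu> \<rho> =
     a * (\<Sum>i\<in>I k. \<bar>\<nu> (Q k i) - ((\<Sum>j\<in>I k. \<rho> i j) - (\<Sum>j\<in>I k. \<rho> j i))\<bar>)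
     + b * (\<Sum>i\<in>I k. \<Sum>j\<in>I k. \<rho> i j * dist (c k i) (c k j))"

text \<open>
  The discretised norm is less than \<open>C\<close>. Unlike \<^const>\<open>W1ab\<close> it sees only the signed measure, so it
  is independent of the decomposition, and it is visibly subadditive.
\<close>

definition flow_bound :: "real \<Rightarrow> real \<Rightarrow> nat \<Rightarrow> ('a set \<Rightarrow> real) \<Rightarrow> real \<Rightarrow> bool" where
  "flow_bound a b k \<nu> C \<longleftrightarrow> (\<exists>\<rho>. (\<forall>i\<in>I k. \<forall>j\<in>I k. 0 \<le> \<rho> i j) \<and> flow_cost a b k \<nu> \<rho> < C)"

lemma flow_bound_cong:
  assumes "flow_bound a b k \<nu> C" "\<And>A. A \<in> sets borel \<Longrightarrow> \<nu> A = \<nu>' A"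
  shows "flow_bound a b k \<nu>' C"
  using assms borel_Q[of _ k] by (simp add: flow_bound_def flow_cost_def cong: sum.cong)

text \<open>Divergence and transport cost are linear in the flow, so flows can simply be added. This
  takes the place of gluing couplings in a triangle inequality.\<close>

lemma flow_bound_add:
  assumes "flow_bound a b k \<nu> C" "flow_bound a b k \<nu>' C'" "0 \<le> a"
  shows "flow_bound a b k (\<lambda>A. \<nu> A + \<nu>' A) (C + C')"
proof -
  obtain \<rho> \<rho>' where nonneg: "\<forall>i\<in>I k. \<forall>j\<in>I k. 0 \<le> \<rho> i j" "\<forall>i\<in>I k. \<forall>j\<in>I k. 0 \<le> \<rho>' i j"
    and less: "flow_cost a b k \<nu> \<rho> < C" "flow_cost a b k \<nu>' \<rho>' < C'"
    using assms unfolding flow_bound_def by blast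
  let ?e = "\<lambda>\<nu> \<rho> i. \<nu> (Q k i) - ((\<Sum>j\<in>I k. \<rho> i j) - (\<Sum>j\<in>I k. \<rho> j i)) :: real"
  have "(\<Sum>i\<in>I k. \<bar>?e (\<lambda>A. \<nu> A + \<nu>' A) (\<lambda>i j. \<rho> i j + \<rho>' i j) i\<bar>) \<le> (\<Sum>i\<in>I k. \<bar>?e \<nu> \<rho> i\<bar> + \<bar>?e \<nu>' \<rho>' i\<bar>)"
    by (intro sum_mono) (simp add: sum.distrib)
  then have "a * (\<Sum>i\<in>I k. \<bar>?e (\<lambda>A. \<nu> A + \<nu>' A) (\<lambda>i j. \<rho> i j + \<rho>' i j) i\<bar>)
      \<le> a * (\<Sum>i\<in>I k. \<bar>?e \<nu> \<rho> i\<bar>) + a * (\<Sum>i\<in>I k. \<bar>?e \<nu>' \<rho>' i\<bar>)"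
    using \<open>0 \<le> a\<close> by (simp add: sum.distrib mult_left_mono flip: distrib_left)
  then have "flow_cost a b k (\<lambda>A. \<nu> A + \<nu>' A) (\<lambda>i j. \<rho> i j + \<rho>' i j)
      \<le> flow_cost a b k \<nu> \<rho> + flow_cost a b k \<nu>' \<rho>'"
    unfolding flow_cost_def by (simp add: distrib_right sum.distrib distrib_left)
  then show ?thesis
    unfolding flow_bound_def using less nonneg
    by (intro exI[of _ "\<lambda>i j. \<rho> i j + \<rho>' i j"]) auto
qed

text \<open>The flow is the coupling seen at the resolution of the cells. On cells its divergence is
  \<open>M' - N'\<close> up to mass that crosses the boundary of the large ball, and
  \<open>M' - N'\<close> differs from \<open>M - N\<close> by what the total variation terms already
  pay for.\<close>

lemma eventually_flow_bound:
  assumes a: "0 < a" and b: "0 < b" and less: "W1ab a b M N < ennreal C"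
  shows "\<forall>\<^sub>F k in sequentially. flow_bound a b k (\<lambda>A. measure M A - measure N A) C"
proof -
  obtain M' N' \<pi> t u where M': "M' \<in> fin_borel_measures" and N': "N' \<in> fin_borel_measures"
    and \<pi>: "\<pi> \<in> couplings M' N'" and t: "0 \<le> t"
    and tv: "ennreal a * (total_variation (\<lambda>A. measure M A - measure M' A)
                   + total_variation (\<lambda>A. measure N A - measure N' A)) = ennreal t"
    and u: "0 \<le> u" and cost: "(\<integral>\<^sup>+ (x, y). ennreal (dist x y) \<partial>\<pi>) = ennreal u" and tu: "t + b * u < C"
    by (rule W1ab_less_obtains[OF b less_imp_le[OF a] less])
  have sets\<pi>[measurable_cong]: "sets \<pi> = sets (borel \<Otimes>\<^sub>M borel)"
    and marg: "distr \<pi> borel fst = M'" "distr \<pi> borel snd = N'"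
    using \<pi> by (auto simp: couplings_def)
  have space\<pi>: "space \<pi> = UNIV" using sets_eq_imp_space_eq[OF sets\<pi>] by (simp add: space_pair_measure)
  have fst: "emeasure \<pi> (A \<times> UNIV) = emeasure M' A" if "A \<in> sets borel" for A
    using that unfolding marg(1)[symmetric]
    by (subst emeasure_distr) (auto simp: space\<pi> intro!: arg_cong[of _ _ "emeasure \<pi>"])
  have snd: "emeasure \<pi> (UNIV \<times> A) = emeasure N' A" if "A \<in> sets borel" for A
    using that unfolding marg(2)[symmetric]
    by (subst emeasure_distr) (auto simp: space\<pi> intro!: arg_cong[of _ _ "emeasure \<pi>"])
  interpret \<pi>: finite_measure \<pi>
  proof
    have "emeasure M' UNIV \<noteq> \<infinity>"
      using finite_measure.emeasure_finite[OF fin_borel_measuresD(2)[OF M']] by simp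
    then show "emeasure \<pi> (space \<pi>) \<noteq> \<infinity>" using fst[of UNIV] space\<pi> by simp
  qed
  have fst': "measure \<pi> (A \<times> UNIV) = measure M' A" if "A \<in> sets borel" for A
    using fst[OF that] by (simp add: measure_def)
  have snd': "measure \<pi> (UNIV \<times> A) = measure N' A" if "A \<in> sets borel" for A
    using snd[OF that] by (simp add: measure_def)
  let ?m = "measure \<pi> UNIV"
  \<comment> \<open>Removal cost, transport cost, the tails outside the ball, and the rounding of
    both endpoints to cell centres. Only \<open>t + b * u\<close> survives in the limit, and it lies
    strictly below \<open>C\<close>.\<close>
  let ?err = "\<lambda>k. t + b * u + a * (measure M' (- cball 0 (real k)) + measure N' (- cball 0 (real k)))
     + b * (2 * ?m * (1 / real (Suc k)))"
  have "?err \<longlonglongrightarrow> t + b * u + a * (0 + 0) + b * (2 * ?m * 0)"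
    using M' N' by (intro tendsto_intros measure_outside_cball_tendsto_0 LIMSEQ_inverse_real_of_nat[unfolded inverse_eq_divide])
  then have "\<forall>\<^sub>F k in sequentially. ?err k < C"
    using tu by (intro order_tendstoD) auto
  then show ?thesis
  proof eventually_elim
    case (elim k)
    let ?I = "I k" and ?Q = "Q k" and ?c = "c k" and ?U = "cball (0::'a) (real k)"
    define \<rho> where "\<rho> i j = measure \<pi> (?Q i \<times> ?Q j)" for i j
    have borel[measurable]: "?Q i \<in> sets borel" if "i \<in> ?I" for i using borel_Q that .
    have union: "(\<Sum>i\<in>?I. measure L (A \<times> ?Q i)) = measure L (A \<times> ?U)"
        "(\<Sum>i\<in>?I. measure L (?Q i \<times> A)) = measure L (?U \<times> A)"
      if "L = \<pi>" "A \<in> sets borel" for A :: "'a set" and L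
    proof -
      have "(\<Sum>i\<in>?I. measure \<pi> (A \<times> ?Q i)) = measure \<pi> (\<Union>i\<in>?I. A \<times> ?Q i)"
        using disjoint_Q[of k] borel that
        by (intro \<pi>.finite_measure_finite_Union[symmetric] finite_I)
          (auto simp: disjoint_family_on_def sets\<pi>)
      moreover have "(\<Sum>i\<in>?I. measure \<pi> (?Q i \<times> A)) = measure \<pi> (\<Union>i\<in>?I. ?Q i \<times> A)"
        using disjoint_Q[of k] borel that
        by (intro \<pi>.finite_measure_finite_Union[symmetric] finite_I)
          (auto simp: disjoint_family_on_def sets\<pi>)
      ultimately show "(\<Sum>i\<in>?I. measure L (A \<times> ?Q i)) = measure L (A \<times> ?U)"
        "(\<Sum>i\<in>?I. measure L (?Q i \<times> A)) = measure L (?U \<times> A)"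
        unfolding that(1) UN_Q[symmetric] by (simp_all only: Sigma_Union UN_extend_simps) (auto intro: arg_cong[of _ _ "measure \<pi>"])
    qed
    have U[measurable]: "?U \<in> sets borel" by simp
    have row: "(\<Sum>j\<in>?I. \<rho> i j) = measure \<pi> (?Q i \<times> ?U)" if "i \<in> ?I" for i
      unfolding \<rho>_def by (rule union(1)) (use borel that in auto)
    have col: "(\<Sum>i\<in>?I. \<rho> i j) = measure \<pi> (?U \<times> ?Q j)" if "j \<in> ?I" for j
      unfolding \<rho>_def by (rule union(2)) (use borel that in auto)
    have row_le: "(\<Sum>j\<in>?I. \<rho> i j) \<le> measure M' (?Q i)" if "i \<in> ?I" for i
      unfolding row[OF that] fst'[OF borel[OF that], symmetric]
      by (intro \<pi>.finite_measure_mono) (use borel[OF that] in \<open>auto simp: sets\<pi>\<close>)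
    have col_le: "(\<Sum>i\<in>?I. \<rho> i j) \<le> measure N' (?Q j)" if "j \<in> ?I" for j
      unfolding col[OF that] snd'[OF borel[OF that], symmetric]
      by (intro \<pi>.finite_measure_mono) (use borel[OF that] in \<open>auto simp: sets\<pi>\<close>)
    \<comment> \<open>The rows fall short of the cell masses by what leaves the ball; that mass
      arrives outside the ball and is therefore part of \<open>N'\<close> there.\<close>
    have sum_row: "(\<Sum>i\<in>?I. measure M' (?Q i) - (\<Sum>j\<in>?I. \<rho> i j)) \<le> measure N' (- ?U)"
    proof -
      have "(\<Sum>i\<in>?I. measure M' (?Q i)) = measure \<pi> (?U \<times> UNIV)"
        using union(2)[of \<pi> UNIV] borel by (simp add: fst')
      moreover have "(\<Sum>i\<in>?I. \<Sum>j\<in>?I. \<rho> i j) = measure \<pi> (?U \<times> ?U)"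
        using union(2)[of \<pi> ?U] by (simp add: row)
      moreover have "measure \<pi> (?U \<times> UNIV) \<le> measure \<pi> (?U \<times> ?U \<union> UNIV \<times> (- ?U))"
        by (intro \<pi>.finite_measure_mono) (auto simp: sets\<pi>)
      moreover have "\<dots> \<le> measure \<pi> (?U \<times> ?U) + measure \<pi> (UNIV \<times> (- ?U))"
        by (intro measure_Un_le) (auto simp: sets\<pi>)
      ultimately show ?thesis by (simp add: sum_subtractf snd')
    qed
    have sum_col: "(\<Sum>j\<in>?I. measure N' (?Q j) - (\<Sum>i\<in>?I. \<rho> i j)) \<le> measure M' (- ?U)"
    proof -
      have "(\<Sum>i\<in>?I. measure N' (?Q i)) = measure \<pi> (UNIV \<times> ?U)"
        using union(1)[of \<pi> UNIV] borel by (simp add: snd')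
      moreover have "(\<Sum>j\<in>?I. \<Sum>i\<in>?I. \<rho> i j) = measure \<pi> (?U \<times> ?U)"
        using union(1)[of \<pi> ?U] by (simp add: col)
      moreover have "measure \<pi> (UNIV \<times> ?U) \<le> measure \<pi> (?U \<times> ?U \<union> (- ?U) \<times> UNIV)"
        by (intro \<pi>.finite_measure_mono) (auto simp: sets\<pi>)
      moreover have "\<dots> \<le> measure \<pi> (?U \<times> ?U) + measure \<pi> ((- ?U) \<times> UNIV)"
        by (intro measure_Un_le) (auto simp: sets\<pi>)
      ultimately show ?thesis by (simp add: sum_subtractf fst')
    qed
    have tv_le: "a * ((\<Sum>i\<in>?I. \<bar>measure M (?Q i) - measure M' (?Q i)\<bar>)
        + (\<Sum>i\<in>?I. \<bar>measure N (?Q i) - measure N' (?Q i)\<bar>)) \<le> t" (is "a * (?s1 + ?s2) \<le> t")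
    proof -
      have "ennreal (a * (?s1 + ?s2)) = ennreal a * (ennreal ?s1 + ennreal ?s2)"
        using a by (simp add: ennreal_mult sum_nonneg)
      also have "\<dots> \<le> ennreal t"
        unfolding tv[symmetric] using borel
        by (intro mult_left_mono add_mono sum_abs_le_total_variation finite_I disjoint_Q) auto
      finally show ?thesis using t by simp
    qed
    have e_le: "(\<Sum>i\<in>?I. \<bar>measure M (?Q i) - measure N (?Q i) - ((\<Sum>j\<in>?I. \<rho> i j) - (\<Sum>j\<in>?I. \<rho> j i))\<bar>)
      \<le> ?s1 + ?s2 + (measure M' (- ?U) + measure N' (- ?U))"
    proof -
      have "(\<Sum>i\<in>?I. \<bar>measure M (?Q i) - measure N (?Q i) - ((\<Sum>j\<in>?I. \<rho> i j) - (\<Sum>j\<in>?I. \<rho> j i))\<bar>)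
        \<le> (\<Sum>i\<in>?I. \<bar>measure M (?Q i) - measure M' (?Q i)\<bar> + \<bar>measure N (?Q i) - measure N' (?Q i)\<bar>
            + (measure M' (?Q i) - (\<Sum>j\<in>?I. \<rho> i j)) + (measure N' (?Q i) - (\<Sum>j\<in>?I. \<rho> j i)))"
      proof (intro sum_mono)
        fix i assume i: "i \<in> ?I"
        show "\<bar>measure M (?Q i) - measure N (?Q i) - ((\<Sum>j\<in>?I. \<rho> i j) - (\<Sum>j\<in>?I. \<rho> j i))\<bar>
          \<le> \<bar>measure M (?Q i) - measure M' (?Q i)\<bar> + \<bar>measure N (?Q i) - measure N' (?Q i)\<bar>
            + (measure M' (?Q i) - (\<Sum>j\<in>?I. \<rho> i j)) + (measure N' (?Q i) - (\<Sum>j\<in>?I. \<rho> j i))"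
          using row_le[OF i] col_le[OF i] by linarith
      qed
      also have "\<dots> = ?s1 + ?s2 + (\<Sum>i\<in>?I. measure M' (?Q i) - (\<Sum>j\<in>?I. \<rho> i j))
          + (\<Sum>i\<in>?I. measure N' (?Q i) - (\<Sum>j\<in>?I. \<rho> j i))"
        by (simp only: sum.distrib)
      finally show ?thesis using sum_row sum_col by linarith
    qed
    have cost_le: "(\<Sum>i\<in>?I. \<Sum>j\<in>?I. \<rho> i j * dist (?c i) (?c j)) \<le> u + 2 * ?m * (1 / real (Suc k))"
    proof -
      let ?h = "1 / real (Suc k)"
      let ?E = "\<lambda>(i, j). ?Q i \<times> ?Q j" and ?d = "\<lambda>(i, j). ennreal (dist (?c i) (?c j))"
      have E: "?E p \<in> sets \<pi>" if "p \<in> ?I \<times> ?I" for p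
        using that borel by (auto simp: sets\<pi>)
      have "ennreal (\<Sum>i\<in>?I. \<Sum>j\<in>?I. \<rho> i j * dist (?c i) (?c j))
          = (\<Sum>i\<in>?I. \<Sum>j\<in>?I. ennreal (dist (?c i) (?c j)) * emeasure \<pi> (?Q i \<times> ?Q j))"
        by (simp add: \<rho>_def sum_nonneg ennreal_mult \<pi>.emeasure_eq_measure mult.commute flip: sum_ennreal)
      also have "\<dots> = (\<Sum>p\<in>?I \<times> ?I. ?d p * emeasure \<pi> (?E p))"
        by (simp add: sum.cartesian_product case_prod_beta)
      also have "\<dots> = (\<integral>\<^sup>+ z. (\<Sum>p\<in>?I \<times> ?I. ?d p * indicator (?E p) z) \<partial>\<pi>)"
        using E by (subst nn_integral_sum) (auto simp: nn_integral_cmult_indicator simp del: split_paired_All)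
      also have "\<dots> \<le> (\<integral>\<^sup>+ z. ennreal (dist (fst z) (snd z)) + ennreal (2 * ?h) \<partial>\<pi>)"
      proof (intro nn_integral_mono sum_indicator_le)
        fix z p assume p: "p \<in> ?I \<times> ?I" "z \<in> ?E p"
        obtain i j where ij: "p = (i, j)" "i \<in> ?I" "j \<in> ?I" using p by auto
        have "dist (?c i) (fst z) < ?h" "dist (?c j) (snd z) < ?h"
          using p(2) ij subsetD[OF Q_subset_ball[OF ij(2)]] subsetD[OF Q_subset_ball[OF ij(3)]] by auto
        then have "dist (?c i) (?c j) \<le> dist (fst z) (snd z) + 2 * ?h"
          using dist_triangle[of "?c i" "?c j" "fst z"] dist_triangle[of "fst z" "?c j" "snd z"]
          by (simp only: dist_commute)
        then have "ennreal (dist (?c i) (?c j)) \<le> ennreal (dist (fst z) (snd z) + 2 * ?h)"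
          by (rule ennreal_leI)
        then show "?d p \<le> ennreal (dist (fst z) (snd z)) + ennreal (2 * ?h)"
          by (simp add: ij)
      next
        show "disjoint_family_on ?E (?I \<times> ?I)"
          using disjoint_Q[of k] by (fastforce simp: disjoint_family_on_def)
      qed (simp add: finite_I)
      also have "\<dots> = ennreal u + ennreal (2 * ?h) * emeasure \<pi> UNIV"
        using cost by (simp add: nn_integral_add case_prod_beta' space\<pi>)
      also have "\<dots> = ennreal (u + 2 * ?m * ?h)"
        using u by (simp add: \<pi>.emeasure_eq_measure ennreal_plus mult_ac flip: ennreal_mult)
      finally show ?thesis using u by (subst (asm) ennreal_le_iff) auto
    qed
    have "flow_cost a b k (\<lambda>A. measure M A - measure N A) \<rho>
        \<le> a * (?s1 + ?s2 + (measure M' (- ?U) + measure N' (- ?U))) + b * (u + 2 * ?m * (1 / real (Suc k)))"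
      unfolding flow_cost_def using a b e_le cost_le by (intro add_mono mult_left_mono) auto
    also have "\<dots> \<le> ?err k" using tv_le by (simp add: distrib_left)
    also have "\<dots> < C" by (rule elim)
    finally show ?case
      unfolding flow_bound_def by (intro exI[of _ \<rho>]) (auto simp: \<rho>_def)
  qed
qed

text \<open>The converse passage: the flow is repaired to a discrete partial plan and spread over
  the cells, while mass outside the ball is left unmatched at price \<open>a\<close>. The result is
  an implication valid from some level on, because how large \<open>k\<close> must be does not
  depend on the flow.\<close>

lemma eventually_plan:
  assumes a: "0 < a" and b: "0 < b" and \<epsilon>: "0 < \<epsilon>"
    and P: "P \<in> fin_borel_measures" and N: "N \<in> fin_borel_measures"
  shows "\<forall>\<^sub>F k in sequentially. flow_bound a b k (\<lambda>A. measure P A - measure N A) C \<longrightarrow>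
     (\<exists>w. is_plan P N w \<and> plan_cost a b P N w < ennreal (C + \<epsilon>))"
proof -
  let ?err = "\<lambda>k. a * (measure P (- cball 0 (real k)) + measure N (- cball 0 (real k)))
     + b * (2 * (1 / real (Suc k)) * measure P UNIV)"
  have "?err \<longlonglongrightarrow> a * (0 + 0) + b * (2 * 0 * measure P UNIV)"
    using P N by (intro tendsto_intros measure_outside_cball_tendsto_0 LIMSEQ_inverse_real_of_nat[unfolded inverse_eq_divide])
  then have "\<forall>\<^sub>F k in sequentially. ?err k < \<epsilon>"
    using \<epsilon> by (intro order_tendstoD) auto
  then show ?thesis
  proof (eventually_elim, intro impI)
    fix k assume err: "?err k < \<epsilon>" and "flow_bound a b k (\<lambda>A. measure P A - measure N A) C"
    then obtain \<rho> where \<rho>: "\<And>i j. i \<in> I k \<Longrightarrow> j \<in> I k \<Longrightarrow> 0 \<le> \<rho> i j"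
      "flow_cost a b k (\<lambda>A. measure P A - measure N A) \<rho> < C"
      unfolding flow_bound_def by blast
    let ?I = "I k" and ?Q = "Q k" and ?c = "c k" and ?U = "cball (0::'a) (real k)"
    let ?d = "\<lambda>i j. dist (?c i) (?c j)"
    have "\<exists>\<sigma>. (\<forall>i\<in>?I. \<forall>j\<in>?I. 0 \<le> \<sigma> i j) \<and>
      (\<forall>i\<in>?I. (\<Sum>j\<in>?I. \<sigma> i j) \<le> measure P (?Q i)) \<and>
      (\<forall>j\<in>?I. (\<Sum>i\<in>?I. \<sigma> i j) \<le> measure N (?Q j)) \<and>
      a * ((\<Sum>i\<in>?I. measure P (?Q i)) + (\<Sum>i\<in>?I. measure N (?Q i)) - 2 * (\<Sum>i\<in>?I. \<Sum>j\<in>?I. \<sigma> i j))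
        + b * (\<Sum>i\<in>?I. \<Sum>j\<in>?I. \<sigma> i j * ?d i j)
       \<le> flow_cost a b k (\<lambda>A. measure P A - measure N A) \<rho>"
      unfolding flow_cost_def using a b
      by (intro flow_to_partial_transport finite_I \<rho>(1)) (auto simp: dist_triangle)
    then obtain \<sigma> where \<sigma>: "\<And>i j. i \<in> ?I \<Longrightarrow> j \<in> ?I \<Longrightarrow> 0 \<le> \<sigma> i j"
      "\<And>i. i \<in> ?I \<Longrightarrow> (\<Sum>j\<in>?I. \<sigma> i j) \<le> measure P (?Q i)"
      "\<And>j. j \<in> ?I \<Longrightarrow> (\<Sum>i\<in>?I. \<sigma> i j) \<le> measure N (?Q j)"
      and "a * ((\<Sum>i\<in>?I. measure P (?Q i)) + (\<Sum>i\<in>?I. measure N (?Q i)) - 2 * (\<Sum>i\<in>?I. \<Sum>j\<in>?I. \<sigma> i j))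
        + b * (\<Sum>i\<in>?I. \<Sum>j\<in>?I. \<sigma> i j * ?d i j) \<le> flow_cost a b k (\<lambda>A. measure P A - measure N A) \<rho>"
      by blast
    note cost = order_le_less_trans[OF this(4) \<rho>(2)]
    define w where "w = step_density ?I ?Q \<sigma> P N"
    have w_swap: "w x y = step_density ?I ?Q (\<lambda>i j. \<sigma> j i) N P y x" for x y
      unfolding w_def by (rule step_density_swap)
    note PN = finite_I[of k] disjoint_Q[of k] borel_Q[of _ k] P N \<sigma>
    \<comment> \<open>The hypotheses for the transposed step density: source and target trade
      places, and so do the row and column bounds.\<close>
    note NP = finite_I[of k] disjoint_Q[of k] borel_Q[of _ k] N P \<sigma>(1) \<sigma>(3) \<sigma>(2)
    let ?S = "\<Sum>i\<in>?I. \<Sum>j\<in>?I. \<sigma> i j"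
    have "is_plan P N w"
      unfolding is_plan_def
    proof (intro conjI allI)
      show "case_prod w \<in> borel_measurable (borel \<Otimes>\<^sub>M borel)"
        unfolding w_def by (rule measurable_step_density[OF PN])
      show "(\<integral>\<^sup>+ y. w x y \<partial>N) \<le> 1" for x
        unfolding w_def by (rule nn_integral_step_density_le_1[OF PN])
      show "(\<integral>\<^sup>+ x. w x y \<partial>P) \<le> 1" for y
        unfolding w_swap by (rule nn_integral_step_density_le_1[OF NP])
    qed
    moreover have "plan_cost a b P N w < ennreal (C + \<epsilon>)"
    proof -
      have r1: "(\<integral>\<^sup>+ x. 1 - (\<integral>\<^sup>+ y. w x y \<partial>N) \<partial>P) = ennreal (measure P UNIV - ?S)"
        unfolding w_def by (rule nn_integral_residual_step_density[OF PN])
      have r2: "(\<integral>\<^sup>+ y. 1 - (\<integral>\<^sup>+ x. w x y \<partial>P) \<partial>N) = ennreal (measure N UNIV - ?S)"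
        unfolding w_swap by (subst sum.swap) (rule nn_integral_residual_step_density[OF NP])
      have r3: "(\<integral>\<^sup>+ x. \<integral>\<^sup>+ y. w x y * ennreal (dist x y) \<partial>N \<partial>P)
        \<le> ennreal ((\<Sum>i\<in>?I. \<Sum>j\<in>?I. \<sigma> i j * ?d i j) + 2 * (1 / real (Suc k)) * ?S)"
        unfolding w_def by (rule nn_integral_dist_step_density[OF PN]) (use Q_subset_ball in auto)
      have cells: "measure L UNIV = (\<Sum>i\<in>?I. measure L (?Q i)) + measure L (- ?U)"
        if L: "L \<in> fin_borel_measures" for L :: "'a measure"
      proof -
        note D = fin_borel_measuresD[OF L]
        have "(\<Sum>i\<in>?I. measure L (?Q i)) = measure L ?U"
          unfolding UN_Q[symmetric] using borel_Q[of _ k] D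
          by (intro finite_measure.finite_measure_finite_Union[symmetric] finite_I disjoint_Q) auto
        moreover have "measure L (- ?U) = measure L UNIV - measure L ?U"
          using finite_measure.finite_measure_compl[OF D(2), of ?U] D by (simp add: Compl_eq_Diff_UNIV)
        ultimately show ?thesis by simp
      qed
      have S_P: "?S \<le> measure P UNIV" "?S \<le> measure N UNIV" "0 \<le> ?S"
      proof -
        have "?S \<le> (\<Sum>i\<in>?I. measure P (?Q i))" by (intro sum_mono \<sigma>(2))
        then show "?S \<le> measure P UNIV" using cells[OF P] measure_nonneg[of P "- ?U"] by linarith
        have "?S \<le> (\<Sum>i\<in>?I. measure N (?Q i))" by (subst sum.swap) (intro sum_mono \<sigma>(3))
        then show "?S \<le> measure N UNIV" using cells[OF N] measure_nonneg[of N "- ?U"] by linarith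
        show "0 \<le> ?S" using \<sigma>(1) by (intro sum_nonneg) auto
      qed
      let ?D = "\<Sum>i\<in>?I. \<Sum>j\<in>?I. \<sigma> i j * ?d i j"
      have D: "0 \<le> ?D" using \<sigma>(1) by (intro sum_nonneg) auto
      have "plan_cost a b P N w \<le> ennreal a * (ennreal (measure P UNIV - ?S) + ennreal (measure N UNIV - ?S))
          + ennreal b * ennreal (?D + 2 * (1 / real (Suc k)) * ?S)"
        unfolding plan_cost_def r1 r2 by (intro add_left_mono mult_left_mono r3) simp
      also have "\<dots> = ennreal (a * ((measure P UNIV - ?S) + (measure N UNIV - ?S)) + b * (?D + 2 * (1 / real (Suc k)) * ?S))"
        using a b S_P D by (intro ennreal_cost) auto
      also have "\<dots> < ennreal (C + \<epsilon>)"
      proof (rule ennreal_lessI)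
        have "b * (2 * (1 / real (Suc k)) * ?S) \<le> b * (2 * (1 / real (Suc k)) * measure P UNIV)"
          using S_P b by (intro mult_left_mono) auto
        moreover have "a * ((measure P UNIV - ?S) + (measure N UNIV - ?S))
          = a * ((\<Sum>i\<in>?I. measure P (?Q i)) + (\<Sum>i\<in>?I. measure N (?Q i)) - 2 * ?S)
            + a * (measure P (- ?U) + measure N (- ?U))"
          unfolding cells[OF P] cells[OF N] by (simp add: algebra_simps)
        ultimately show less: "a * ((measure P UNIV - ?S) + (measure N UNIV - ?S)) + b * (?D + 2 * (1 / real (Suc k)) * ?S) < C + \<epsilon>"
          using cost err by (simp only: distrib_left)
        have "0 \<le> a * ((measure P UNIV - ?S) + (measure N UNIV - ?S)) + b * (?D + 2 * (1 / real (Suc k)) * ?S)"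
          using a b S_P D by (intro add_nonneg_nonneg mult_nonneg_nonneg) auto
        with less show "0 < C + \<epsilon>" by linarith
      qed
      finally show ?thesis .
    qed
    ultimately show "\<exists>w. is_plan P N w \<and> plan_cost a b P N w < ennreal (C + \<epsilon>)" by blast
  qed
qed

end

section \<open>Plans from flow bounds: cancellation and subadditivity\<close>

lemma cell_grid_exists: "\<exists>I Q (c :: nat \<Rightarrow> nat \<Rightarrow> 'a::euclidean_space). cell_grid I Q c"
proof -
  have "\<forall>k. \<exists>(I :: nat set) Q (c :: nat \<Rightarrow> 'a). finite I \<and> disjoint_family_on Q I \<and>
    (\<forall>i\<in>I. Q i \<in> sets borel \<and> Q i \<subseteq> ball (c i) (1 / real (Suc k))) \<and> (\<Union>i\<in>I. Q i) = cball 0 (real k)"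
    by (intro allI exists_cells) simp
  then obtain I :: "nat \<Rightarrow> nat set" and Q and c :: "nat \<Rightarrow> nat \<Rightarrow> 'a"
    where "\<forall>k. finite (I k) \<and> disjoint_family_on (Q k) (I k) \<and>
    (\<forall>i\<in>I k. Q k i \<in> sets borel \<and> Q k i \<subseteq> ball (c k i) (1 / real (Suc k))) \<and> (\<Union>i\<in>I k. Q k i) = cball 0 (real k)"
    unfolding choice_iff by blast
  then show ?thesis unfolding cell_grid_def by blast
qed

lemma (in cell_grid) plan_exists_of_flow_bound:
  assumes ab: "0 < a" "0 < b" "0 < \<epsilon>"
    and PN: "P \<in> fin_borel_measures" "N \<in> fin_borel_measures"
    and bound: "\<forall>\<^sub>F k in sequentially. flow_bound a b k \<nu> C"
    and eq: "\<And>A. A \<in> sets borel \<Longrightarrow> \<nu> A = measure P A - measure N A"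
  shows "\<exists>w. is_plan P N w \<and> plan_cost a b P N w < ennreal (C + \<epsilon>)"
proof -
  have "\<forall>\<^sub>F k in sequentially. \<exists>w. is_plan P N w \<and> plan_cost a b P N w < ennreal (C + \<epsilon>)"
    using bound eventually_plan[OF ab PN, of C]
  proof eventually_elim
    case (elim k)
    then show ?case using flow_bound_cong[OF elim(1) eq] by blast
  qed
  \<comment> \<open>The assertion no longer depends on \<open>k\<close>, so one suitable level is
    enough.\<close>
  then show ?thesis by simp
qed

text \<open>
  Together with the converse estimate \<open>W1ab_le_plan_cost\<close> below, this is the cancellation property:
  the cost depends on the two measures only through their difference.
\<close>

lemma plan_exists:
  fixes P N :: "'a::euclidean_space measure"
  assumes ab: "0 < a" "0 < b" "0 < \<epsilon>"
    and PN: "P \<in> fin_borel_measures" "N \<in> fin_borel_measures"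
    and eq: "\<And>A. A \<in> sets borel \<Longrightarrow> measure M A - measure L A = measure P A - measure N A"
    and less: "W1ab a b M L < ennreal C"
  shows "\<exists>w. is_plan P N w \<and> plan_cost a b P N w < ennreal (C + \<epsilon>)"
proof -
  obtain I Q and c :: "nat \<Rightarrow> nat \<Rightarrow> 'a" where "cell_grid I Q c" using cell_grid_exists by blast
  then interpret cell_grid I Q c .
  show ?thesis
    by (rule plan_exists_of_flow_bound[OF ab PN eventually_flow_bound[OF ab(1,2) less] eq])
qed

text \<open>The triangle inequality in the form needed for (ii) \<Longrightarrow> (i). One grid
  serves all three pairs, so their flows live on the same graph and are added at a common level
  before a plan is built.\<close>

lemma plan_exists_sum3:
  fixes P N :: "'a::euclidean_space measure"
  assumes ab: "0 < a" "0 < b" "0 < \<epsilon>"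
    and PN: "P \<in> fin_borel_measures" "N \<in> fin_borel_measures"
    and eq: "\<And>A. A \<in> sets borel \<Longrightarrow> (measure M1 A - measure L1 A) + (measure M2 A - measure L2 A)
      + (measure M3 A - measure L3 A) = measure P A - measure N A"
    and less: "W1ab a b M1 L1 < ennreal C1" "W1ab a b M2 L2 < ennreal C2" "W1ab a b M3 L3 < ennreal C3"
  shows "\<exists>w. is_plan P N w \<and> plan_cost a b P N w < ennreal (C1 + C2 + C3 + \<epsilon>)"
proof -
  obtain I Q and c :: "nat \<Rightarrow> nat \<Rightarrow> 'a" where "cell_grid I Q c" using cell_grid_exists by blast
  then interpret cell_grid I Q c .
  have "\<forall>\<^sub>F k in sequentially. flow_bound a b k (\<lambda>A. (measure M1 A - measure L1 A)
      + (measure M2 A - measure L2 A) + (measure M3 A - measure L3 A)) (C1 + C2 + C3)"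
    using eventually_flow_bound[OF ab(1,2) less(1)] eventually_flow_bound[OF ab(1,2) less(2)]
      eventually_flow_bound[OF ab(1,2) less(3)]
    by eventually_elim (intro flow_bound_add less_imp_le[OF ab(1)])
  then show ?thesis by (rule plan_exists_of_flow_bound[OF ab PN _ eq])
qed

section \<open>Transport by densities\<close>

lemma fin_borel_sigma_finite:
  assumes "M \<in> fin_borel_measures"
  shows "sigma_finite_measure M"
  using fin_borel_measuresD(2)[OF assms] by (rule finite_measure.axioms)

lemma sets_pair_fin_borel:
  assumes "M \<in> fin_borel_measures" "N \<in> fin_borel_measures"
  shows "sets (M \<Otimes>\<^sub>M N) = sets (borel \<Otimes>\<^sub>M borel)"
  using fin_borel_measuresD(1)[OF assms(1)] fin_borel_measuresD(1)[OF assms(2)]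
  by (intro sets_pair_measure_cong)

lemma Fubini_fin_borel:
  fixes f :: "'a::euclidean_space \<Rightarrow> 'a \<Rightarrow> ennreal"
  assumes M: "M \<in> fin_borel_measures" and N: "N \<in> fin_borel_measures"
    and f: "case_prod f \<in> borel_measurable (borel \<Otimes>\<^sub>M borel)"
  shows "(\<integral>\<^sup>+ z. f (fst z) (snd z) \<partial>(M \<Otimes>\<^sub>M N)) = (\<integral>\<^sup>+ x. \<integral>\<^sup>+ y. f x y \<partial>N \<partial>M)"
    and "(\<integral>\<^sup>+ y. \<integral>\<^sup>+ x. f x y \<partial>M \<partial>N) = (\<integral>\<^sup>+ x. \<integral>\<^sup>+ y. f x y \<partial>N \<partial>M)"
    and "(\<lambda>x. \<integral>\<^sup>+ y. f x y \<partial>N) \<in> borel_measurable borel"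
    and "(\<lambda>y. \<integral>\<^sup>+ x. f x y \<partial>M) \<in> borel_measurable borel"
proof -
  interpret M: sigma_finite_measure M by (rule fin_borel_sigma_finite[OF M])
  interpret N: sigma_finite_measure N by (rule fin_borel_sigma_finite[OF N])
  interpret pair_sigma_finite M N ..
  have [measurable_cong]: "sets M = sets borel" "sets N = sets borel"
    using fin_borel_measuresD(1) M N by auto
  have f': "(\<lambda>z. f (fst z) (snd z)) \<in> borel_measurable (M \<Otimes>\<^sub>M N)"
    using f by (simp add: case_prod_beta' measurable_cong_sets[OF sets_pair_fin_borel[OF M N] refl])
  show "(\<integral>\<^sup>+ z. f (fst z) (snd z) \<partial>(M \<Otimes>\<^sub>M N)) = (\<integral>\<^sup>+ x. \<integral>\<^sup>+ y. f x y \<partial>N \<partial>M)"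
    using N.nn_integral_fst[OF f'] by simp
  show "(\<integral>\<^sup>+ y. \<integral>\<^sup>+ x. f x y \<partial>M \<partial>N) = (\<integral>\<^sup>+ x. \<integral>\<^sup>+ y. f x y \<partial>N \<partial>M)"
    using N.nn_integral_fst[OF f'] nn_integral_snd[OF f'] by simp
  have [measurable]: "case_prod f \<in> borel_measurable (borel \<Otimes>\<^sub>M borel)" by (rule f)
  show "(\<lambda>x. \<integral>\<^sup>+ y. f x y \<partial>N) \<in> borel_measurable borel" by measurable
  show "(\<lambda>y. \<integral>\<^sup>+ x. f x y \<partial>M) \<in> borel_measurable borel" by measurable
qed

lemma density_fin_borel:
  fixes A :: "'a::euclidean_space measure"
  assumes A: "A \<in> fin_borel_measures" and p: "p \<in> borel_measurable borel" "\<And>x. p x \<le> 1"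
  shows "density A p \<in> fin_borel_measures"
    and "S \<in> sets borel \<Longrightarrow> emeasure (density A p) S = (\<integral>\<^sup>+ x. p x * indicator S x \<partial>A)"
proof -
  have [measurable_cong]: "sets A = sets borel" and sp: "space A = UNIV"
    using fin_borel_measuresD[OF A] by auto
  note p(1)[measurable]
  show *: "emeasure (density A p) S = (\<integral>\<^sup>+ x. p x * indicator S x \<partial>A)" if "S \<in> sets borel" for S
    using that by (subst emeasure_density) auto
  have "emeasure (density A p) UNIV \<le> (\<integral>\<^sup>+ x. 1 \<partial>A)"
    unfolding *[OF sets.top[of borel, unfolded space_borel]] using p(2) by (intro nn_integral_mono) auto
  also have "\<dots> < \<infinity>"
    using finite_measure.emeasure_finite[OF fin_borel_measuresD(2)[OF A]] sp by (simp add: less_top)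
  finally show "density A p \<in> fin_borel_measures"
    by (auto simp: fin_borel_measures_def sp fin_borel_measuresD(1)[OF A] intro!: finite_measureI)
qed

text \<open>The caps \<open>p\<close> and \<open>n\<close> make one estimate serve three situations:
  both constantly \<open>1\<close> for a full plan, complements of marginals for unmatched mass, and
  a marginal against \<open>1\<close> for matched mass. The competitors are the two marginals of
  \<open>w\<close>; lying below the given measures, they cost only the mass they omit.\<close>

lemma W1ab_density_le:
  fixes A B :: "'a::euclidean_space measure" and w :: "'a \<Rightarrow> 'a \<Rightarrow> ennreal"
  assumes ab: "0 \<le> a" "0 \<le> b" and A: "A \<in> fin_borel_measures" and B: "B \<in> fin_borel_measures"
    and w: "case_prod w \<in> borel_measurable (borel \<Otimes>\<^sub>M borel)"
    and p: "p \<in> borel_measurable borel" "\<And>x. (\<integral>\<^sup>+ y. w x y \<partial>B) \<le> p x" "\<And>x. p x \<le> 1"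
    and n: "n \<in> borel_measurable borel" "\<And>y. (\<integral>\<^sup>+ x. w x y \<partial>A) \<le> n y" "\<And>y. n y \<le> 1"
  shows "W1ab a b (density A p) (density B n)
    \<le> ennreal a * ((\<integral>\<^sup>+ x. p x - (\<integral>\<^sup>+ y. w x y \<partial>B) \<partial>A) + (\<integral>\<^sup>+ y. n y - (\<integral>\<^sup>+ x. w x y \<partial>A) \<partial>B))
      + ennreal b * (\<integral>\<^sup>+ x. \<integral>\<^sup>+ y. w x y * ennreal (dist x y) \<partial>B \<partial>A)"
proof -
  note AB = A B
  have sA[measurable_cong]: "sets A = sets borel" and sB[measurable_cong]: "sets B = sets borel"
    and sp: "space A = UNIV" "space B = UNIV"
    using fin_borel_measuresD[OF A] fin_borel_measuresD[OF B] by auto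
  note sAB = sets_pair_fin_borel[OF A B]
  note w[measurable] p(1)[measurable] n(1)[measurable]
  define f where "f x = (\<integral>\<^sup>+ y. w x y \<partial>B)" for x
  define g where "g y = (\<integral>\<^sup>+ x. w x y \<partial>A)" for y
  have f[measurable]: "f \<in> borel_measurable borel" and g[measurable]: "g \<in> borel_measurable borel"
    using Fubini_fin_borel(3,4)[OF A B w] by (simp_all add: f_def[abs_def] g_def[abs_def])
  have f_le: "f x \<le> p x" "f x \<le> 1" for x using p(2,3)[of x] by (auto simp: f_def)
  have g_le: "g y \<le> n y" "g y \<le> 1" for y using n(2,3)[of y] by (auto simp: g_def)
  let ?M = "density A f" and ?N = "density B g"
  have M: "?M \<in> fin_borel_measures" and N: "?N \<in> fin_borel_measures"
    using density_fin_borel(1)[OF A f f_le(2)] density_fin_borel(1)[OF B g g_le(2)] by auto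
  \<comment> \<open>The weighted product measure is itself the coupling; integrating in either order
    computes its marginals.\<close>
  define \<pi> where "\<pi> = density (A \<Otimes>\<^sub>M B) (\<lambda>z. w (fst z) (snd z))"
  have w'[measurable]: "(\<lambda>z. w (fst z) (snd z)) \<in> borel_measurable (A \<Otimes>\<^sub>M B)"
    using w by (simp add: case_prod_beta' measurable_cong_sets[OF sAB refl])
  have sets\<pi>: "sets \<pi> = sets (borel \<Otimes>\<^sub>M borel)" using sAB by (simp add: \<pi>_def)
  note [measurable_cong] = sets\<pi>
  have space\<pi>: "space \<pi> = UNIV" using sets_eq_imp_space_eq[OF sets\<pi>] by (simp add: space_pair_measure)
  have int\<pi>: "(\<integral>\<^sup>+ z. h (fst z) (snd z) \<partial>\<pi>) = (\<integral>\<^sup>+ x. \<integral>\<^sup>+ y. w x y * h x y \<partial>B \<partial>A)"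
      "(\<integral>\<^sup>+ z. h (fst z) (snd z) \<partial>\<pi>) = (\<integral>\<^sup>+ y. \<integral>\<^sup>+ x. w x y * h x y \<partial>A \<partial>B)"
    if h[measurable]: "case_prod h \<in> borel_measurable (borel \<Otimes>\<^sub>M borel)" for h :: "'a \<Rightarrow> 'a \<Rightarrow> ennreal"
  proof -
    have h': "(\<lambda>z. h (fst z) (snd z)) \<in> borel_measurable (A \<Otimes>\<^sub>M B)"
      using h by (simp add: case_prod_beta' measurable_cong_sets[OF sAB refl])
    have wh: "(\<lambda>(x, y). w x y * h x y) \<in> borel_measurable (borel \<Otimes>\<^sub>M borel)"
      using w h by (simp add: case_prod_beta')
    show 1: "(\<integral>\<^sup>+ z. h (fst z) (snd z) \<partial>\<pi>) = (\<integral>\<^sup>+ x. \<integral>\<^sup>+ y. w x y * h x y \<partial>B \<partial>A)"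
      unfolding \<pi>_def using Fubini_fin_borel(1)[OF A B wh] h' by (simp add: nn_integral_density)
    show "(\<integral>\<^sup>+ z. h (fst z) (snd z) \<partial>\<pi>) = (\<integral>\<^sup>+ y. \<integral>\<^sup>+ x. w x y * h x y \<partial>A \<partial>B)"
      unfolding 1 by (rule Fubini_fin_borel(2)[OF A B wh, symmetric])
  qed
  have "distr \<pi> borel fst = ?M"
  proof (rule measure_eqI)
    fix S :: "'a set" assume "S \<in> sets (distr \<pi> borel fst)"
    then have S[measurable]: "S \<in> sets borel" by simp
    have "emeasure (distr \<pi> borel fst) S = (\<integral>\<^sup>+ x. indicator S x \<partial>distr \<pi> borel fst)" by simp
    also have "\<dots> = (\<integral>\<^sup>+ z. indicator S (fst z) \<partial>\<pi>)"
      by (subst nn_integral_distr) auto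
    also have "\<dots> = (\<integral>\<^sup>+ x. \<integral>\<^sup>+ y. w x y * indicator S x \<partial>B \<partial>A)"
      by (rule int\<pi>(1)) measurable
    also have "\<dots> = emeasure ?M S"
      using S by (simp add: density_fin_borel(2)[OF A f f_le(2)] f_def nn_integral_multc)
    finally show "emeasure (distr \<pi> borel fst) S = emeasure ?M S" .
  qed (simp add: sA)
  moreover have "distr \<pi> borel snd = ?N"
  proof (rule measure_eqI)
    fix S :: "'a set" assume "S \<in> sets (distr \<pi> borel snd)"
    then have S[measurable]: "S \<in> sets borel" by simp
    have "emeasure (distr \<pi> borel snd) S = (\<integral>\<^sup>+ x. indicator S x \<partial>distr \<pi> borel snd)" by simp
    also have "\<dots> = (\<integral>\<^sup>+ z. indicator S (snd z) \<partial>\<pi>)"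
      by (subst nn_integral_distr) auto
    also have "\<dots> = (\<integral>\<^sup>+ y. \<integral>\<^sup>+ x. w x y * indicator S y \<partial>A \<partial>B)"
      by (rule int\<pi>(2)) measurable
    also have "\<dots> = emeasure ?N S"
      using S by (simp add: density_fin_borel(2)[OF B g g_le(2)] g_def nn_integral_multc)
    finally show "emeasure (distr \<pi> borel snd) S = emeasure ?N S" .
  qed (simp add: sB)
  ultimately have marg: "distr \<pi> borel fst = ?M" "distr \<pi> borel snd = ?N" .
  then have coupling: "\<pi> \<in> couplings ?M ?N" by (simp add: couplings_def sets\<pi>)
  have mass: "emeasure ?M UNIV = emeasure ?N UNIV"
    unfolding marg[symmetric] by (simp add: emeasure_distr space\<pi>)
  have W1: "W1 ?M ?N \<le> (\<integral>\<^sup>+ x. \<integral>\<^sup>+ y. w x y * ennreal (dist x y) \<partial>B \<partial>A)"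
  proof -
    have "W1 ?M ?N \<le> (\<integral>\<^sup>+ (x, y). ennreal (dist x y) \<partial>\<pi>)"
      unfolding W1_def by (rule INF_lower[OF coupling])
    also have "\<dots> = (\<integral>\<^sup>+ z. ennreal (dist (fst z) (snd z)) \<partial>\<pi>)" by (simp add: case_prod_beta')
    also have "\<dots> = (\<integral>\<^sup>+ x. \<integral>\<^sup>+ y. w x y * ennreal (dist x y) \<partial>B \<partial>A)"
      by (rule int\<pi>(1)) measurable
    finally show ?thesis .
  qed
  have tv: "total_variation (\<lambda>S. measure (density L q) S - measure (density L r) S) \<le> (\<integral>\<^sup>+ x. q x - r x \<partial>L)"
    if L: "L \<in> fin_borel_measures" and q: "q \<in> borel_measurable borel" and q1: "\<And>x. q x \<le> 1"
      and r: "r \<in> borel_measurable borel" and rq: "\<And>x. r x \<le> q x" for L :: "'a measure" and q r :: "'a \<Rightarrow> ennreal"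
  proof -
    have r1: "r x \<le> 1" for x using rq q1 order_trans by blast
    note Dq = density_fin_borel[OF L q q1] and Dr = density_fin_borel[OF L r r1]
    have [measurable_cong]: "sets L = sets borel" by (rule fin_borel_measuresD(1)[OF L])
    note q[measurable] r[measurable]
    interpret q: finite_measure "density L q" by (rule fin_borel_measuresD(2)[OF Dq(1)])
    interpret r: finite_measure "density L r" by (rule fin_borel_measuresD(2)[OF Dr(1)])
    have "measure (density L r) S \<le> measure (density L q) S" if "S \<in> sets borel" for S
    proof -
      have "emeasure (density L r) S \<le> emeasure (density L q) S"
        unfolding Dq(2)[OF that] Dr(2)[OF that] by (intro nn_integral_mono mult_right_mono rq) simp
      then show ?thesis by (simp add: q.emeasure_eq_measure r.emeasure_eq_measure)
    qed
    then have "total_variation (\<lambda>S. measure (density L q) S - measure (density L r) S)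
        \<le> ennreal (measure (density L q) UNIV - measure (density L r) UNIV)"
      by (rule total_variation_diff_le[OF Dq(1) Dr(1)])
    also have "\<dots> = emeasure (density L q) UNIV - emeasure (density L r) UNIV"
      by (simp add: q.emeasure_eq_measure r.emeasure_eq_measure ennreal_minus)
    also have "\<dots> = (\<integral>\<^sup>+ x. q x \<partial>L) - (\<integral>\<^sup>+ x. r x \<partial>L)"
      using Dq(2)[of UNIV] Dr(2)[of UNIV] by simp
    also have "\<dots> = (\<integral>\<^sup>+ x. q x - r x \<partial>L)"
    proof (rule nn_integral_diff[symmetric])
      show "(\<integral>\<^sup>+ x. r x \<partial>L) \<noteq> \<infinity>" using Dr(2)[of UNIV] r.emeasure_finite[of UNIV] by simp
    qed (use rq in auto)
    finally show ?thesis .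
  qed
  have "W1ab a b (density A p) (density B n)
    \<le> ennreal a * (total_variation (\<lambda>S. measure (density A p) S - measure ?M S)
                   + total_variation (\<lambda>S. measure (density B n) S - measure ?N S))
        + ennreal b * W1 ?M ?N"
    unfolding W1ab_def using M N mass by (intro INF_lower2[of "(?M, ?N)"]) auto
  also have "\<dots> \<le> ennreal a * ((\<integral>\<^sup>+ x. p x - f x \<partial>A) + (\<integral>\<^sup>+ y. n y - g y \<partial>B))
      + ennreal b * (\<integral>\<^sup>+ x. \<integral>\<^sup>+ y. w x y * ennreal (dist x y) \<partial>B \<partial>A)"
    by (intro add_mono mult_left_mono tv W1 A B p(1,3) n(1,3) f g f_le(1) g_le(1)) auto
  finally show ?thesis by (simp add: f_def g_def)
qed

text \<open>A Chebyshev-type bound: mass that starts in \<open>E\<close> outside \<open>S\<close>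
  and lands outside \<open>T\<close> travels at least \<open>\<delta>\<close>, so it amounts to at
  most the cost divided by \<open>\<delta>\<close>; the rest is charged to \<open>S\<close> or
  \<open>T\<close>. It controls both the transport between singular parts (\<open>E\<close> the
  whole space) and the tails (\<open>S\<close> empty, \<open>\<delta> = 1\<close>).\<close>

lemma plan_mass_le:
  fixes A B :: "'a::euclidean_space measure" and w :: "'a \<Rightarrow> 'a \<Rightarrow> ennreal"
  assumes A: "A \<in> fin_borel_measures" and B: "B \<in> fin_borel_measures"
    and w: "case_prod w \<in> borel_measurable (borel \<Otimes>\<^sub>M borel)"
    and le: "\<And>x. (\<integral>\<^sup>+ y. w x y \<partial>B) \<le> 1" "\<And>y. (\<integral>\<^sup>+ x. w x y \<partial>A) \<le> 1"
    and sets: "E \<in> sets borel" "S \<in> sets borel" "T \<in> sets borel" and "0 < \<delta>"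
    and sep: "\<And>x y. x \<in> E \<Longrightarrow> x \<notin> S \<Longrightarrow> y \<notin> T \<Longrightarrow> \<delta> \<le> dist x y"
  shows "(\<integral>\<^sup>+ x. (\<integral>\<^sup>+ y. w x y \<partial>B) * indicator E x \<partial>A)
    \<le> emeasure A S + emeasure B T + ennreal (1 / \<delta>) * (\<integral>\<^sup>+ x. \<integral>\<^sup>+ y. w x y * ennreal (dist x y) \<partial>B \<partial>A)"
proof -
  have sA[measurable_cong]: "sets A = sets borel" and sB[measurable_cong]: "sets B = sets borel"
    using fin_borel_measuresD[OF A] fin_borel_measuresD[OF B] by auto
  interpret A: sigma_finite_measure A by (rule fin_borel_sigma_finite[OF A])
  interpret B: sigma_finite_measure B by (rule fin_borel_sigma_finite[OF B])
  note w[measurable] sets[measurable]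
  have "w x y * indicator E x
     \<le> w x y * indicator S x + w x y * indicator T y + ennreal (1 / \<delta>) * (w x y * ennreal (dist x y))" for x y
  proof (cases "x \<in> E \<and> x \<notin> S \<and> y \<notin> T")
    case True
    then have "1 \<le> 1 / \<delta> * dist x y" using sep[of x y] \<open>0 < \<delta>\<close> by (simp add: field_simps)
    then have "1 \<le> ennreal (1 / \<delta>) * ennreal (dist x y)"
      using \<open>0 < \<delta>\<close> by (subst ennreal_mult[symmetric]) auto
    then have "w x y * 1 \<le> w x y * (ennreal (1 / \<delta>) * ennreal (dist x y))" by (rule mult_left_mono) simp
    then show ?thesis using True by (simp add: mult_ac)
  qed (auto simp: indicator_def add_increasing2)
  then have "(\<integral>\<^sup>+ x. \<integral>\<^sup>+ y. w x y * indicator E x \<partial>B \<partial>A) \<le> (\<integral>\<^sup>+ x. \<integral>\<^sup>+ y. w x y * indicator S x + w x y * indicator T y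
      + ennreal (1 / \<delta>) * (w x y * ennreal (dist x y)) \<partial>B \<partial>A)"
    by (intro nn_integral_mono)
  also have "\<dots> = (\<integral>\<^sup>+ x. \<integral>\<^sup>+ y. w x y * indicator S x \<partial>B \<partial>A) + (\<integral>\<^sup>+ x. \<integral>\<^sup>+ y. w x y * indicator T y \<partial>B \<partial>A)
      + ennreal (1 / \<delta>) * (\<integral>\<^sup>+ x. \<integral>\<^sup>+ y. w x y * ennreal (dist x y) \<partial>B \<partial>A)"
    by (simp add: nn_integral_add nn_integral_cmult)
  also have "(\<integral>\<^sup>+ x. \<integral>\<^sup>+ y. w x y * indicator S x \<partial>B \<partial>A) \<le> emeasure A S"
  proof -
    have "(\<integral>\<^sup>+ x. \<integral>\<^sup>+ y. w x y * indicator S x \<partial>B \<partial>A) = (\<integral>\<^sup>+ x. (\<integral>\<^sup>+ y. w x y \<partial>B) * indicator S x \<partial>A)"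
      by (simp add: nn_integral_multc)
    also have "\<dots> \<le> (\<integral>\<^sup>+ x. 1 * indicator S x \<partial>A)"
      by (intro nn_integral_mono mult_right_mono le) simp
    finally show ?thesis using sets sA by simp
  qed
  also have "(\<integral>\<^sup>+ x. \<integral>\<^sup>+ y. w x y * indicator T y \<partial>B \<partial>A) \<le> emeasure B T"
  proof -
    have m: "(\<lambda>(x, y). w x y * indicator T y) \<in> borel_measurable (borel \<Otimes>\<^sub>M borel)" by measurable
    have "(\<integral>\<^sup>+ x. \<integral>\<^sup>+ y. w x y * indicator T y \<partial>B \<partial>A) = (\<integral>\<^sup>+ y. \<integral>\<^sup>+ x. w x y * indicator T y \<partial>A \<partial>B)"
      by (rule Fubini_fin_borel(2)[OF A B m, symmetric])
    also have "\<dots> = (\<integral>\<^sup>+ y. (\<integral>\<^sup>+ x. w x y \<partial>A) * indicator T y \<partial>B)"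
      by (simp add: nn_integral_multc)
    also have "\<dots> \<le> (\<integral>\<^sup>+ y. 1 * indicator T y \<partial>B)"
      by (intro nn_integral_mono mult_right_mono le) simp
    finally show ?thesis using sets sB by simp
  qed
  finally show ?thesis by (simp add: nn_integral_multc add_right_mono)
qed

text \<open>\<open>is_measure_sum\<close> fixes values on Borel sets only. Building functions up
  from indicators transfers it to integrals, so the marginals of a plan split along with the
  measures.\<close>

lemma nn_integral_is_measure_sum:
  fixes M P Q :: "'a::euclidean_space measure"
  assumes "is_measure_sum M P Q"
    and [measurable_cong]: "sets M = sets borel" "sets P = sets borel" "sets Q = sets borel"
    and f: "f \<in> borel_measurable borel"
  shows "(\<integral>\<^sup>+ x. f x \<partial>M) = (\<integral>\<^sup>+ x. f x \<partial>P) + (\<integral>\<^sup>+ x. f x \<partial>Q)"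
  using f
proof (induction rule: borel_measurable_induct)
  case (cong f g)
  then show ?case by (simp add: space_borel cong: nn_integral_cong)
next
  case (set A)
  then show ?case using assms(1,2,3,4) by (simp add: is_measure_sum_def)
next
  case (mult u c)
  then show ?case by (simp add: nn_integral_cmult distrib_left)
next
  case (add u v)
  then show ?case by (simp add: nn_integral_add add_ac)
next
  case (seq U)
  note seq(1)[measurable]
  have *: "(\<integral>\<^sup>+ x. (SUP i. U i) x \<partial>L) = (SUP i. \<integral>\<^sup>+ x. U i x \<partial>L)" if "sets L = sets borel" for L :: "'a measure"
  proof -
    have [measurable_cong]: "sets L = sets borel" by (rule that)
    show ?thesis using seq(3) unfolding SUP_apply by (intro nn_integral_monotone_convergence_SUP) auto
  qed
  have inc: "incseq (\<lambda>i. \<integral>\<^sup>+ x. U i x \<partial>L)" for L :: "'a measure"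
    using seq(3) by (auto simp: incseq_def le_fun_def intro!: nn_integral_mono)
  show ?case
    using seq.IH unfolding *[OF assms(2)] *[OF assms(3)] *[OF assms(4)]
    by (simp add: ennreal_SUP_add[OF inc inc])
qed

lemma measure_sum_exists:
  fixes P Q :: "'a::euclidean_space measure"
  assumes P: "P \<in> fin_borel_measures" and Q: "Q \<in> fin_borel_measures"
  shows "\<exists>M \<in> fin_borel_measures. is_measure_sum M P Q"
proof
  let ?\<mu> = "\<lambda>A. emeasure P A + emeasure Q A"
  let ?M = "measure_of UNIV (sets borel) ?\<mu>"
  note D = fin_borel_measuresD[OF P] fin_borel_measuresD[OF Q]
  have sets: "sets ?M = sets borel" using sets.sigma_sets_eq[of "borel :: 'a measure"] by simp
  have em: "emeasure ?M A = ?\<mu> A" if "A \<in> sets borel" for A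
  proof (rule emeasure_measure_of_sigma)
    show "sigma_algebra UNIV (sets (borel :: 'a measure))"
      using sets.sigma_algebra_axioms[of "borel :: 'a measure"] by simp
    show "positive (sets borel) ?\<mu>" by (simp add: positive_def)
    show "countably_additive (sets borel) ?\<mu>"
    proof (rule countably_additiveI)
      fix A :: "nat \<Rightarrow> 'a set"
      assume "range A \<subseteq> sets borel" "disjoint_family A"
      then show "(\<Sum>i. ?\<mu> (A i)) = ?\<mu> (\<Union>i. A i)"
        using D suminf_emeasure[of A P] suminf_emeasure[of A Q] by (simp add: suminf_add[symmetric])
    qed
  qed fact
  show "is_measure_sum ?M P Q" unfolding is_measure_sum_def using em by blast
  have "emeasure ?M UNIV \<noteq> \<infinity>"
    using em[of UNIV] finite_measure.emeasure_finite[OF D(2)] finite_measure.emeasure_finite[OF D(5)] by simp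
  then show "?M \<in> fin_borel_measures"
    using sets by (auto simp: fin_borel_measures_def intro!: finite_measureI)
qed

section \<open>Splitting a plan\<close>

lemma nn_integral_is_measure_sum_ge:
  fixes M P Q :: "'a::euclidean_space measure"
  assumes "is_measure_sum M P Q" "M \<in> fin_borel_measures" "P \<in> fin_borel_measures" "Q \<in> fin_borel_measures"
    and f: "f \<in> borel_measurable borel"
  shows "(\<integral>\<^sup>+ x. f x \<partial>P) \<le> (\<integral>\<^sup>+ x. f x \<partial>M)" "(\<integral>\<^sup>+ x. f x \<partial>Q) \<le> (\<integral>\<^sup>+ x. f x \<partial>M)"
  using nn_integral_is_measure_sum[OF assms(1) fin_borel_measuresD(1)[OF assms(2)]
      fin_borel_measuresD(1)[OF assms(3)] fin_borel_measuresD(1)[OF assms(4)] f]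
  by simp_all

lemma measure_is_measure_sum:
  assumes "is_measure_sum M P Q" "P \<in> fin_borel_measures" "Q \<in> fin_borel_measures" "A \<in> sets borel"
  shows "measure M A = measure P A + measure Q A"
proof -
  have "emeasure M A = ennreal (measure P A + measure Q A)"
    using assms by (simp add: is_measure_sum_def finite_measure.emeasure_eq_measure fin_borel_measuresD(2))
  then show ?thesis by (intro measure_eq_emeasure_eq_ennreal) auto
qed

lemma is_plan_swap:
  assumes "is_plan P N w"
  shows "is_plan N P (\<lambda>x y. w y x)"
proof -
  have [measurable]: "case_prod w \<in> borel_measurable (borel \<Otimes>\<^sub>M borel)"
    using assms by (simp add: is_plan_def)
  have "(\<lambda>(x, y). w y x) \<in> borel_measurable (borel \<Otimes>\<^sub>M borel)" by measurable
  then show ?thesis using assms by (simp add: is_plan_def)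
qed

lemma plan_cost_swap:
  assumes P: "P \<in> fin_borel_measures" and N: "N \<in> fin_borel_measures" and w: "is_plan P N w"
  shows "plan_cost a b N P (\<lambda>x y. w y x) = plan_cost a b P N w"
    and "(\<integral>\<^sup>+ x. \<integral>\<^sup>+ y. w y x * ennreal (dist x y) \<partial>P \<partial>N) = (\<integral>\<^sup>+ x. \<integral>\<^sup>+ y. w x y * ennreal (dist x y) \<partial>N \<partial>P)"
proof -
  have [measurable]: "case_prod w \<in> borel_measurable (borel \<Otimes>\<^sub>M borel)"
    using w by (simp add: is_plan_def)
  have "(\<lambda>(x, y). w x y * ennreal (dist x y)) \<in> borel_measurable (borel \<Otimes>\<^sub>M borel)" by measurable
  from Fubini_fin_borel(2)[OF P N this]
  show *: "(\<integral>\<^sup>+ x. \<integral>\<^sup>+ y. w y x * ennreal (dist x y) \<partial>P \<partial>N) = (\<integral>\<^sup>+ x. \<integral>\<^sup>+ y. w x y * ennreal (dist x y) \<partial>N \<partial>P)"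
    by (simp add: dist_commute)
  show "plan_cost a b N P (\<lambda>x y. w y x) = plan_cost a b P N w"
    unfolding plan_cost_def * by (simp add: add.commute)
qed

lemma W1ab_le_plan_cost:
  assumes "0 \<le> a" "0 \<le> b" "P \<in> fin_borel_measures" "N \<in> fin_borel_measures" "is_plan P N w"
  shows "W1ab a b P N \<le> plan_cost a b P N w"
  using W1ab_density_le[OF assms(1-4), of w "\<lambda>_. 1" "\<lambda>_. 1"] assms(5)
  by (simp add: is_plan_def plan_cost_def density_1)

context
  fixes A B A' B' P N :: "'a::euclidean_space measure" and w :: "'a \<Rightarrow> 'a \<Rightarrow> ennreal" and a b :: real
  assumes ab: "0 < a" "0 < b"
    and A: "A \<in> fin_borel_measures" and B: "B \<in> fin_borel_measures"
    and A': "A' \<in> fin_borel_measures" and B': "B' \<in> fin_borel_measures"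
    and P: "P \<in> fin_borel_measures" and N: "N \<in> fin_borel_measures"
    and sumP: "is_measure_sum P A B" and sumN: "is_measure_sum N A' B'"
    and plan: "is_plan P N w"
begin

text \<open>In the application \<open>A\<close>, \<open>B\<close>, \<open>A'\<close>,
  \<open>B'\<close> are \<open>\<mu>s_pos n\<close>, \<open>\<mu>_neg\<close>,
  \<open>\<mu>s_neg n\<close>, \<open>\<mu>_pos\<close>. Of the four blocks of \<open>w\<close>, the
  one from \<open>A\<close> to \<open>A'\<close> gives the vanishing pair, those from
  \<open>A\<close> to \<open>B'\<close> and from \<open>B\<close> to \<open>A'\<close> give the
  convergent parts, and the one from \<open>B\<close> to \<open>B'\<close> joins mutually singular
  measures.\<close>

lemma split_plan_facts:
  shows "case_prod w \<in> borel_measurable (borel \<Otimes>\<^sub>M borel)"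
    and "w x \<in> borel_measurable borel" and "(\<lambda>x. w x y) \<in> borel_measurable borel"
    and "(\<integral>\<^sup>+ y. w x y \<partial>A') + (\<integral>\<^sup>+ y. w x y \<partial>B') = (\<integral>\<^sup>+ y. w x y \<partial>N)"
    and "(\<integral>\<^sup>+ x. w x y \<partial>A) + (\<integral>\<^sup>+ x. w x y \<partial>B) = (\<integral>\<^sup>+ x. w x y \<partial>P)"
    and "(\<integral>\<^sup>+ y. w x y \<partial>N) \<le> 1" and "(\<integral>\<^sup>+ x. w x y \<partial>P) \<le> 1"
    and "(\<integral>\<^sup>+ y. w x y \<partial>A') \<le> 1" and "(\<integral>\<^sup>+ y. w x y \<partial>B') \<le> 1"
    and "(\<integral>\<^sup>+ x. w x y \<partial>A) \<le> 1" and "(\<integral>\<^sup>+ x. w x y \<partial>B) \<le> 1"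
proof -
  show w[measurable]: "case_prod w \<in> borel_measurable (borel \<Otimes>\<^sub>M borel)"
    using plan by (simp add: is_plan_def)
  show wx: "w x \<in> borel_measurable borel" for x using measurable_Pair2[OF w, of x] by simp
  show wy: "(\<lambda>x. w x y) \<in> borel_measurable borel" for y using measurable_Pair1[OF w, of y] by simp
  show N1: "(\<integral>\<^sup>+ y. w x y \<partial>N) \<le> 1" and P1: "(\<integral>\<^sup>+ x. w x y \<partial>P) \<le> 1" for x y
    using plan by (auto simp: is_plan_def)
  note D = fin_borel_measuresD(1)
  show "(\<integral>\<^sup>+ y. w x y \<partial>A') + (\<integral>\<^sup>+ y. w x y \<partial>B') = (\<integral>\<^sup>+ y. w x y \<partial>N)"
    by (rule nn_integral_is_measure_sum[OF sumN D[OF N] D[OF A'] D[OF B'] wx, symmetric])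
  show "(\<integral>\<^sup>+ x. w x y \<partial>A) + (\<integral>\<^sup>+ x. w x y \<partial>B) = (\<integral>\<^sup>+ x. w x y \<partial>P)"
    by (rule nn_integral_is_measure_sum[OF sumP D[OF P] D[OF A] D[OF B] wy, symmetric])
  show "(\<integral>\<^sup>+ y. w x y \<partial>A') \<le> 1" "(\<integral>\<^sup>+ y. w x y \<partial>B') \<le> 1"
    using nn_integral_is_measure_sum_ge[OF sumN N A' B' wx] N1 order_trans by blast+
  show "(\<integral>\<^sup>+ x. w x y \<partial>A) \<le> 1" "(\<integral>\<^sup>+ x. w x y \<partial>B) \<le> 1"
    using nn_integral_is_measure_sum_ge[OF sumP P A B wy] P1 order_trans by blast+
qed

lemma nn_integral_sub_plan:
  fixes h :: "'a \<Rightarrow> 'a \<Rightarrow> ennreal"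
  assumes "L \<in> {A, B}" "L' \<in> {A', B'}" "case_prod h \<in> borel_measurable (borel \<Otimes>\<^sub>M borel)"
  shows "(\<integral>\<^sup>+ x. \<integral>\<^sup>+ y. h x y \<partial>L' \<partial>L) \<le> (\<integral>\<^sup>+ x. \<integral>\<^sup>+ y. h x y \<partial>N \<partial>P)"
proof -
  have hx: "h x \<in> borel_measurable borel" for x using measurable_Pair2[OF assms(3), of x] by simp
  have "(\<integral>\<^sup>+ x. \<integral>\<^sup>+ y. h x y \<partial>L' \<partial>L) \<le> (\<integral>\<^sup>+ x. \<integral>\<^sup>+ y. h x y \<partial>N \<partial>L)"
    using nn_integral_is_measure_sum_ge[OF sumN N A' B' hx] assms(2) by (intro nn_integral_mono) auto
  also have "\<dots> \<le> (\<integral>\<^sup>+ x. \<integral>\<^sup>+ y. h x y \<partial>N \<partial>P)"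
    using nn_integral_is_measure_sum_ge[OF sumP P A B Fubini_fin_borel(3)[OF P N assms(3)]] assms(1) by auto
  finally show ?thesis .
qed

lemma measurable_plan_dist: "(\<lambda>(x, y). w x y * ennreal (dist x y)) \<in> borel_measurable (borel \<Otimes>\<^sub>M borel)"
proof -
  note split_plan_facts(1)[measurable]
  show ?thesis by measurable
qed

lemma measurable_plan_marginals:
  "(\<lambda>x. \<integral>\<^sup>+ y. w x y \<partial>B') \<in> borel_measurable borel" "(\<lambda>x. \<integral>\<^sup>+ y. w x y \<partial>N) \<in> borel_measurable borel"
  "(\<lambda>y. \<integral>\<^sup>+ x. w x y \<partial>B) \<in> borel_measurable borel" "(\<lambda>y. \<integral>\<^sup>+ x. w x y \<partial>P) \<in> borel_measurable borel"
  using Fubini_fin_borel(3,4)[OF B B' split_plan_facts(1)] Fubini_fin_borel(3,4)[OF P N split_plan_facts(1)]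
  by auto

text \<open>Only the block from \<open>A\<close> to \<open>A'\<close> is used. Since the mass
  exchanged with \<open>B'\<close> or \<open>B\<close> has been taken out beforehand, what a point
  still lacks is exactly what it lacks in the whole plan, and a block costs no more than the
  whole.\<close>

lemma W1ab_unmatched_le:
  "W1ab a b (density A (\<lambda>x. 1 - (\<integral>\<^sup>+ y. w x y \<partial>B'))) (density A' (\<lambda>y. 1 - (\<integral>\<^sup>+ x. w x y \<partial>B)))
    \<le> plan_cost a b P N w"
proof -
  note facts = split_plan_facts
  \<comment> \<open>Truncated subtraction behaves like real subtraction here because the marginals
    are at most \<open>1\<close>.\<close>
  have minus: "1 - s - t = 1 - r" if "t + s = r" "r \<le> 1" for r s t :: ennreal
    using that by (cases r; cases s; cases t)
      (auto simp: ennreal_minus diff_diff_eq add.commute simp flip: ennreal_1 ennreal_plus)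
  have le_minus: "t \<le> 1 - s" if "t + s = r" "r \<le> 1" for r s t :: ennreal
    using that by (simp add: ennreal_le_minus_iff)
  have "W1ab a b (density A (\<lambda>x. 1 - (\<integral>\<^sup>+ y. w x y \<partial>B'))) (density A' (\<lambda>y. 1 - (\<integral>\<^sup>+ x. w x y \<partial>B)))
    \<le> ennreal a * ((\<integral>\<^sup>+ x. 1 - (\<integral>\<^sup>+ y. w x y \<partial>B') - (\<integral>\<^sup>+ y. w x y \<partial>A') \<partial>A)
        + (\<integral>\<^sup>+ y. 1 - (\<integral>\<^sup>+ x. w x y \<partial>B) - (\<integral>\<^sup>+ x. w x y \<partial>A) \<partial>A'))
      + ennreal b * (\<integral>\<^sup>+ x. \<integral>\<^sup>+ y. w x y * ennreal (dist x y) \<partial>A' \<partial>A)"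
  proof (rule W1ab_density_le[OF _ _ A A' facts(1)])
    show "(\<integral>\<^sup>+ y. w x y \<partial>A') \<le> 1 - (\<integral>\<^sup>+ y. w x y \<partial>B')" for x by (rule le_minus[OF facts(4,6)])
    show "(\<integral>\<^sup>+ x. w x y \<partial>A) \<le> 1 - (\<integral>\<^sup>+ x. w x y \<partial>B)" for y by (rule le_minus[OF facts(5,7)])
  qed (use ab measurable_plan_marginals in \<open>auto intro: diff_le_self_ennreal\<close>)
  also have "\<dots> = ennreal a * ((\<integral>\<^sup>+ x. 1 - (\<integral>\<^sup>+ y. w x y \<partial>N) \<partial>A) + (\<integral>\<^sup>+ y. 1 - (\<integral>\<^sup>+ x. w x y \<partial>P) \<partial>A'))
      + ennreal b * (\<integral>\<^sup>+ x. \<integral>\<^sup>+ y. w x y * ennreal (dist x y) \<partial>A' \<partial>A)"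
    by (simp only: minus[OF facts(4,6)] minus[OF facts(5,7)])
  also have "\<dots> \<le> plan_cost a b P N w"
    unfolding plan_cost_def using measurable_plan_marginals
    by (intro add_mono mult_left_mono nn_integral_sub_plan measurable_plan_dist
        nn_integral_is_measure_sum_ge(1)[OF sumP P A B] nn_integral_is_measure_sum_ge(1)[OF sumN N A' B']) auto
  finally show ?thesis .
qed

text \<open>The first measure is by construction what \<open>w\<close> sends to \<open>B'\<close>,
  so nothing is removed on that side. A point of \<open>B'\<close> lacks mass only if the whole plan
  leaves it short, which is already paid for, or if it is served by \<open>B\<close>; the latter is
  the transport between singular parts. \<open>S\<close>, \<open>T\<close> and
  \<open>\<delta>\<close> stay free so that they can be chosen independently of the plan.\<close>

lemma W1ab_matched_le:
  assumes sets: "S \<in> sets borel" "T \<in> sets borel" and "0 < \<delta>"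
    and sep: "\<And>x y. x \<notin> S \<Longrightarrow> y \<notin> T \<Longrightarrow> \<delta> \<le> dist x y"
  shows "W1ab a b (density A (\<lambda>x. \<integral>\<^sup>+ y. w x y \<partial>B')) B'
    \<le> plan_cost a b P N w + ennreal a * (emeasure B S + emeasure B' T
        + ennreal (1 / \<delta>) * (\<integral>\<^sup>+ x. \<integral>\<^sup>+ y. w x y * ennreal (dist x y) \<partial>N \<partial>P))"
proof -
  note facts = split_plan_facts
  have sB': "sets B' = sets borel" by (rule fin_borel_measuresD(1)[OF B'])
  \<comment> \<open>With \<open>r\<close> the total received, \<open>s\<close> the part from
    \<open>A\<close> and \<open>t\<close> the part from \<open>B\<close>: not being served by
    \<open>A\<close> means being unserved or served by \<open>B\<close>.\<close>
  have diff: "1 - s \<le> (1 - r) + t" if "s + t = r" "r \<le> 1" for r s t :: ennreal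
    using that by (cases r; cases s; cases t)
      (auto simp: ennreal_minus simp flip: ennreal_1 ennreal_plus)
  have self: "r - r = 0" if "r \<le> 1" for r :: ennreal
    using that by (cases r) (auto simp: top_unique)
  have "W1ab a b (density A (\<lambda>x. \<integral>\<^sup>+ y. w x y \<partial>B')) (density B' (\<lambda>_. 1))
    \<le> ennreal a * ((\<integral>\<^sup>+ x. (\<integral>\<^sup>+ y. w x y \<partial>B') - (\<integral>\<^sup>+ y. w x y \<partial>B') \<partial>A) + (\<integral>\<^sup>+ y. 1 - (\<integral>\<^sup>+ x. w x y \<partial>A) \<partial>B'))
      + ennreal b * (\<integral>\<^sup>+ x. \<integral>\<^sup>+ y. w x y * ennreal (dist x y) \<partial>B' \<partial>A)"
    by (rule W1ab_density_le[OF _ _ A B' facts(1)]) (use ab measurable_plan_marginals facts in auto)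
  also have "(\<integral>\<^sup>+ x. (\<integral>\<^sup>+ y. w x y \<partial>B') - (\<integral>\<^sup>+ y. w x y \<partial>B') \<partial>A) = 0"
    by (simp add: self[OF facts(9)])
  also have "(\<integral>\<^sup>+ x. \<integral>\<^sup>+ y. w x y * ennreal (dist x y) \<partial>B' \<partial>A) \<le> (\<integral>\<^sup>+ x. \<integral>\<^sup>+ y. w x y * ennreal (dist x y) \<partial>N \<partial>P)"
    by (rule nn_integral_sub_plan[OF _ _ measurable_plan_dist]) auto
  also have "(\<integral>\<^sup>+ y. 1 - (\<integral>\<^sup>+ x. w x y \<partial>A) \<partial>B')
    \<le> (\<integral>\<^sup>+ x. 1 - (\<integral>\<^sup>+ y. w x y \<partial>N) \<partial>P) + (\<integral>\<^sup>+ y. 1 - (\<integral>\<^sup>+ x. w x y \<partial>P) \<partial>N)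
       + (emeasure B S + emeasure B' T
        + ennreal (1 / \<delta>) * (\<integral>\<^sup>+ x. \<integral>\<^sup>+ y. w x y * ennreal (dist x y) \<partial>N \<partial>P))"
  proof -
    have "(\<integral>\<^sup>+ y. 1 - (\<integral>\<^sup>+ x. w x y \<partial>A) \<partial>B') \<le> (\<integral>\<^sup>+ y. (1 - (\<integral>\<^sup>+ x. w x y \<partial>P)) + (\<integral>\<^sup>+ x. w x y \<partial>B) \<partial>B')"
      by (intro nn_integral_mono diff[OF facts(5,7)])
    also have "\<dots> = (\<integral>\<^sup>+ y. 1 - (\<integral>\<^sup>+ x. w x y \<partial>P) \<partial>B') + (\<integral>\<^sup>+ y. \<integral>\<^sup>+ x. w x y \<partial>B \<partial>B')"
      using measurable_plan_marginals by (intro nn_integral_add) (auto simp: measurable_cong_sets[OF sB' refl])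
    also have "(\<integral>\<^sup>+ y. 1 - (\<integral>\<^sup>+ x. w x y \<partial>P) \<partial>B') \<le> (\<integral>\<^sup>+ y. 1 - (\<integral>\<^sup>+ x. w x y \<partial>P) \<partial>N)"
      using measurable_plan_marginals by (intro nn_integral_is_measure_sum_ge(2)[OF sumN N A' B']) auto
    also have "(\<integral>\<^sup>+ y. \<integral>\<^sup>+ x. w x y \<partial>B \<partial>B') = (\<integral>\<^sup>+ x. (\<integral>\<^sup>+ y. w x y \<partial>B') * indicator UNIV x \<partial>B)"
      using Fubini_fin_borel(2)[OF B B' facts(1)] by simp
    also have "\<dots> \<le> emeasure B S + emeasure B' T
        + ennreal (1 / \<delta>) * (\<integral>\<^sup>+ x. \<integral>\<^sup>+ y. w x y * ennreal (dist x y) \<partial>B' \<partial>B)"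
      by (rule plan_mass_le[OF B B' facts(1)]) (use facts sets \<open>0 < \<delta>\<close> sep in auto)
    also have "(\<integral>\<^sup>+ x. \<integral>\<^sup>+ y. w x y * ennreal (dist x y) \<partial>B' \<partial>B) \<le> (\<integral>\<^sup>+ x. \<integral>\<^sup>+ y. w x y * ennreal (dist x y) \<partial>N \<partial>P)"
      by (rule nn_integral_sub_plan[OF _ _ measurable_plan_dist]) auto
    finally show ?thesis by (simp add: add_increasing add.assoc add_left_mono mult_left_mono add_right_mono)
  qed
  finally show ?thesis
    by (simp add: density_1 plan_cost_def distrib_left add_ac add_left_mono mult_left_mono)
qed

text \<open>No point of \<open>B'\<close> receives more than it holds, and matched mass from beyond
  radius \<open>R + 1\<close> either lands beyond radius \<open>R\<close> or travels at least
  \<open>1\<close>. The bounds involve only \<open>B'\<close> and the transport cost, which makes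
  them uniform along a sequence.\<close>

lemma emeasure_matched_le:
  "emeasure (density A (\<lambda>x. \<integral>\<^sup>+ y. w x y \<partial>B')) UNIV \<le> emeasure B' UNIV"
  "emeasure (density A (\<lambda>x. \<integral>\<^sup>+ y. w x y \<partial>B')) (- cball 0 (R + 1))
     \<le> emeasure B' (- cball 0 R) + (\<integral>\<^sup>+ x. \<integral>\<^sup>+ y. w x y * ennreal (dist x y) \<partial>N \<partial>P)"
proof -
  note facts = split_plan_facts
  note em = density_fin_borel(2)[OF A measurable_plan_marginals(1) facts(9)]
  have "emeasure (density A (\<lambda>x. \<integral>\<^sup>+ y. w x y \<partial>B')) UNIV = (\<integral>\<^sup>+ x. \<integral>\<^sup>+ y. w x y \<partial>B' \<partial>A)"
    using em[of UNIV] by simp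
  also have "\<dots> = (\<integral>\<^sup>+ y. \<integral>\<^sup>+ x. w x y \<partial>A \<partial>B')"
    by (rule Fubini_fin_borel(2)[OF A B' facts(1), symmetric])
  also have "\<dots> \<le> (\<integral>\<^sup>+ y. 1 \<partial>B')" by (intro nn_integral_mono facts)
  finally show "emeasure (density A (\<lambda>x. \<integral>\<^sup>+ y. w x y \<partial>B')) UNIV \<le> emeasure B' UNIV"
    using fin_borel_measuresD[OF B'] by simp
  have "emeasure (density A (\<lambda>x. \<integral>\<^sup>+ y. w x y \<partial>B')) (- cball 0 (R + 1))
      = (\<integral>\<^sup>+ x. (\<integral>\<^sup>+ y. w x y \<partial>B') * indicator (- cball 0 (R + 1)) x \<partial>A)"
    by (rule em) (intro borel_comp borel_closed closed_cball)
  also have "\<dots> \<le> emeasure A {} + emeasure B' (- cball 0 R)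
        + ennreal (1 / 1) * (\<integral>\<^sup>+ x. \<integral>\<^sup>+ y. w x y * ennreal (dist x y) \<partial>B' \<partial>A)"
  proof (rule plan_mass_le[OF A B' facts(1)])
    fix x y :: 'a assume "x \<in> - cball 0 (R + 1)" "y \<notin> - cball 0 R"
    then have "R + 1 < norm x" "norm y \<le> R" by auto
    then show "1 \<le> dist x y" using norm_triangle_ineq2[of x y] by (simp only: dist_norm)
  qed (use facts in \<open>auto intro!: borel_comp\<close>)
  also have "(\<integral>\<^sup>+ x. \<integral>\<^sup>+ y. w x y * ennreal (dist x y) \<partial>B' \<partial>A) \<le> (\<integral>\<^sup>+ x. \<integral>\<^sup>+ y. w x y * ennreal (dist x y) \<partial>N \<partial>P)"
    by (rule nn_integral_sub_plan[OF _ _ measurable_plan_dist]) auto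
  finally show "emeasure (density A (\<lambda>x. \<integral>\<^sup>+ y. w x y \<partial>B')) (- cball 0 (R + 1))
     \<le> emeasure B' (- cball 0 R) + (\<integral>\<^sup>+ x. \<integral>\<^sup>+ y. w x y * ennreal (dist x y) \<partial>N \<partial>P)"
    by (simp add: add_left_mono)
qed

lemma is_measure_sum_unmatched_matched:
  "is_measure_sum A (density A (\<lambda>x. 1 - (\<integral>\<^sup>+ y. w x y \<partial>B'))) (density A (\<lambda>x. \<integral>\<^sup>+ y. w x y \<partial>B'))"
  unfolding is_measure_sum_def
proof
  fix S :: "'a set" assume S: "S \<in> sets borel"
  note facts = split_plan_facts
  have sA[measurable_cong]: "sets A = sets borel" by (rule fin_borel_measuresD(1)[OF A])
  note S[measurable] measurable_plan_marginals[measurable]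
  have eq: "(1 - s) * t + s * t = t" if "s \<le> 1" for s t :: ennreal
    using that by (simp add: diff_add_cancel_ennreal flip: distrib_right)
  have "emeasure (density A (\<lambda>x. 1 - (\<integral>\<^sup>+ y. w x y \<partial>B'))) S = (\<integral>\<^sup>+ x. (1 - (\<integral>\<^sup>+ y. w x y \<partial>B')) * indicator S x \<partial>A)"
    by (rule density_fin_borel(2)[OF A _ _ S]) (auto intro: diff_le_self_ennreal)
  moreover have "emeasure (density A (\<lambda>x. \<integral>\<^sup>+ y. w x y \<partial>B')) S = (\<integral>\<^sup>+ x. (\<integral>\<^sup>+ y. w x y \<partial>B') * indicator S x \<partial>A)"
    by (rule density_fin_borel(2)[OF A _ _ S]) (auto intro: facts)
  moreover have "(\<integral>\<^sup>+ x. (1 - (\<integral>\<^sup>+ y. w x y \<partial>B')) * indicator S x \<partial>A) + (\<integral>\<^sup>+ x. (\<integral>\<^sup>+ y. w x y \<partial>B') * indicator S x \<partial>A)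
     = (\<integral>\<^sup>+ x. indicator S x \<partial>A)"
    by (subst nn_integral_add[symmetric]) (auto simp: eq[OF facts(9)])
  ultimately show "emeasure A S = emeasure (density A (\<lambda>x. 1 - (\<integral>\<^sup>+ y. w x y \<partial>B'))) S
      + emeasure (density A (\<lambda>x. \<integral>\<^sup>+ y. w x y \<partial>B')) S"
    using S sA by simp
qed

lemma matched_in_fin_borel:
  "density A (\<lambda>x. \<integral>\<^sup>+ y. w x y \<partial>B') \<in> fin_borel_measures"
  "density A (\<lambda>x. 1 - (\<integral>\<^sup>+ y. w x y \<partial>B')) \<in> fin_borel_measures"
  using measurable_plan_marginals split_plan_facts(9)
  by (auto intro!: density_fin_borel(1)[OF A] diff_le_self_ennreal)

end

section \<open>Convergence\<close>

lemma ennreal_tendsto_0_iff: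
  fixes f :: "'b \<Rightarrow> ennreal"
  shows "(f \<longlongrightarrow> 0) F \<longleftrightarrow> (\<forall>e>0. \<forall>\<^sub>F x in F. f x < ennreal e)"
proof
  assume "(f \<longlongrightarrow> 0) F"
  then show "\<forall>e>0. \<forall>\<^sub>F x in F. f x < ennreal e" by (auto intro: order_tendstoD)
next
  assume *: "\<forall>e>0. \<forall>\<^sub>F x in F. f x < ennreal e"
  show "(f \<longlongrightarrow> 0) F"
  proof (rule order_tendstoI)
    fix c :: ennreal assume "0 < c"
    then obtain r where "ennreal r < c" "0 < ennreal r"
      using dense[of 0 c] by (metis ennreal_cases ennreal_less_top less_top order_less_trans not_less_iff_gr_or_eq)
    then have "\<forall>\<^sub>F x in F. f x < ennreal r" using * by (simp add: ennreal_less_zero_iff)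
    then show "\<forall>\<^sub>F x in F. f x < c" by eventually_elim (use \<open>ennreal r < c\<close> in order)
  qed simp
qed

lemma decomposes_diff:
  assumes P: "decomposes \<mu> P N" and Q: "decomposes \<nu> P' N'"
    and M: "M \<in> fin_borel_measures" "is_measure_sum M P N'"
    and L: "L \<in> fin_borel_measures" "is_measure_sum L N P'"
  shows "decomposes (\<lambda>A. \<mu> A - \<nu> A) M L"
  unfolding decomposes_def
proof (intro conjI ext M(1) L(1))
  fix A :: "'a set"
  have fin: "P \<in> fin_borel_measures" "N \<in> fin_borel_measures" "P' \<in> fin_borel_measures" "N' \<in> fin_borel_measures"
    using P Q by (auto simp: decomposes_def)
  have \<mu>\<nu>: "\<mu> A = measure P A - measure N A" "\<nu> A = measure P' A - measure N' A"
    using P Q by (auto simp: decomposes_def)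
  show "\<mu> A - \<nu> A = measure M A - measure L A"
  proof (cases "A \<in> sets borel")
    case True
    then show ?thesis
      unfolding \<mu>\<nu> measure_is_measure_sum[OF M(2) fin(1,4) True] measure_is_measure_sum[OF L(2) fin(2,3) True]
      by simp
  next
    case False
    \<comment> \<open>Equality of signed measures means equality on all sets; off the Borel sets
      every \<open>measure\<close> is \<open>0\<close> by convention.\<close>
    have "measure X A = 0" if "X \<in> fin_borel_measures" for X
      using False fin_borel_measuresD(1)[OF that] by (intro measure_notin_sets) simp
    then show ?thesis using fin M(1) L(1) by (simp add: \<mu>\<nu>)
  qed
qed

text \<open>The choice yields the value for some decomposition and reveals nothing about which.
  Later uses of \<open>norm_ab\<close> start from this unknown pair and compare differences
  only.\<close>

lemma norm_ab_obtains:
  assumes "decomposes \<nu> P N"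
  obtains M L where "decomposes \<nu> M L" "norm_ab a b \<nu> = W1ab a b M L"
proof -
  have "\<exists>w M L. decomposes \<nu> M L \<and> w = W1ab a b M L" using assms by blast
  from someI_ex[OF this] show thesis using that unfolding norm_ab_def by blast
qed

lemma plan_le_norm_ab:
  assumes ab: "0 < a" "0 < b" and \<epsilon>: "0 < \<epsilon>" and dec: "decomposes \<nu> P N"
  shows "\<exists>w. is_plan P N w \<and> plan_cost a b P N w \<le> norm_ab a b \<nu> + ennreal \<epsilon>"
proof (cases "norm_ab a b \<nu>")
  case (real r)
  obtain M L where M: "decomposes \<nu> M L" "norm_ab a b \<nu> = W1ab a b M L"
    using norm_ab_obtains[OF dec] by blast
  have fin: "P \<in> fin_borel_measures" "N \<in> fin_borel_measures" using dec by (auto simp: decomposes_def)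
  have eq: "measure M A - measure L A = measure P A - measure N A" for A
    using dec M(1) unfolding decomposes_def by metis
  \<comment> \<open>One half of \<open>\<epsilon>\<close> makes the inequality strict, the other
    half covers the discretisation loss.\<close>
  have "W1ab a b M L < ennreal (r + \<epsilon> / 2)"
    using real M(2) \<epsilon> by (simp add: ennreal_lessI)
  from plan_exists[OF ab half_gt_zero[OF \<epsilon>] fin eq this]
  obtain w where "is_plan P N w" "plan_cost a b P N w < ennreal (r + \<epsilon> / 2 + \<epsilon> / 2)" by blast
  then show ?thesis using real \<epsilon> by (intro exI[of _ w]) (simp add: ennreal_plus add.commute less_imp_le)
next
  case top
  \<comment> \<open>With an infinite right-hand side any plan will do; the zero density moves
    nothing.\<close>
  have "is_plan P N (\<lambda>_ _. 0)" by (simp add: is_plan_def)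
  then show ?thesis using top by auto
qed

lemma fin_borel_inner_compact:
  fixes M :: "'a::euclidean_space measure"
  assumes M: "M \<in> fin_borel_measures" and H: "H \<in> sets borel" "measure M (- H) = 0" and \<epsilon>: "0 < \<epsilon>"
  shows "\<exists>K. compact K \<and> K \<subseteq> H \<and> measure M (- K) < \<epsilon>"
proof -
  note D = fin_borel_measuresD[OF M]
  interpret finite_measure M by (rule D(2))
  have full: "measure M H = measure M UNIV"
    using finite_measure_compl[of H] H D by (simp add: Compl_eq_Diff_UNIV)
  show ?thesis
  \<comment> \<open>The null measure is treated apart: negative reals become \<open>0\<close> in
    \<open>ennreal\<close>, so the strict inequality used below would read
    \<open>0 < 0\<close>.\<close>
  proof (cases "measure M UNIV = 0")
    case True
    have "measure M (- {}) = 0" using True by simp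
    then show ?thesis using \<epsilon> by (intro exI[of _ "{}"]) auto
  next
    case False
    then have pos: "0 < measure M H" using full by (simp add: less_le)
    have "ennreal (measure M H - \<epsilon>) < emeasure M H"
      using pos \<epsilon> by (simp add: emeasure_eq_measure ennreal_lessI)
    also have "\<dots> = (SUP K \<in> {K. K \<subseteq> H \<and> compact K}. emeasure M K)"
      by (rule inner_regular[OF D(1) _ H(1)]) simp
    finally have "ennreal (measure M H - \<epsilon>) < (SUP K \<in> {K. K \<subseteq> H \<and> compact K}. emeasure M K)" .
    then obtain K where K: "K \<subseteq> H" "compact K" "ennreal (measure M H - \<epsilon>) < emeasure M K"
      unfolding less_SUP_iff by blast
    then have "measure M H - \<epsilon> < measure M K"
      unfolding emeasure_eq_measure by (metis ennreal_leI not_le)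
    moreover have "measure M (- K) = measure M UNIV - measure M K"
      using finite_measure_compl[of K] D K(2) by (simp add: Compl_eq_Diff_UNIV borel_compact)
    ultimately have "measure M (- K) < \<epsilon>" using full by linarith
    then show ?thesis using K by blast
  qed
qed

section \<open>Uniform mass bounds, tightness and separation\<close>

lemma bounded_in_massI:
  assumes B: "B \<in> fin_borel_measures" and le: "\<And>n. emeasure (m n) UNIV \<le> emeasure B UNIV"
  shows "bounded_in_mass m"
proof -
  have "(SUP n. emeasure (m n) UNIV) \<le> emeasure B UNIV" using le by (rule SUP_least)
  also have "\<dots> < \<infinity>"
    using finite_measure.emeasure_finite[OF fin_borel_measuresD(2)[OF B]] by (simp add: less_top)
  finally show ?thesis by (simp add: bounded_in_mass_def)
qed

text \<open>The estimate helps only where \<open>\<kappa> n\<close> is small. The finitely many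
  remaining indices are handled singly, since each finite measure has small tails, and one radius
  covers all of them.\<close>

lemma tight_seqI:
  fixes m :: "nat \<Rightarrow> 'a::euclidean_space measure" and B :: "'a measure"
  assumes B: "B \<in> fin_borel_measures" and m: "\<And>n. m n \<in> fin_borel_measures"
    and le: "\<And>n R. emeasure (m n) (- cball 0 (R + 1)) \<le> emeasure B (- cball 0 R) + \<kappa> n"
    and \<kappa>: "\<kappa> \<longlonglongrightarrow> 0"
  shows "tight_seq m"
  unfolding tight_seq_def
proof (intro allI impI)
  fix \<epsilon> :: real assume \<epsilon>: "0 < \<epsilon>"
  have em: "emeasure L A = ennreal (measure L A)" if "L \<in> fin_borel_measures" for L :: "'a measure" and A
    by (rule finite_measure.emeasure_eq_measure[OF fin_borel_measuresD(2)[OF that]])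
  have tail: "\<exists>k0. \<forall>k\<ge>k0. measure L (- cball 0 (real k)) < \<epsilon> / 2" if "L \<in> fin_borel_measures" for L :: "'a measure"
    using order_tendstoD(2)[OF measure_outside_cball_tendsto_0[OF that], of "\<epsilon> / 2"] \<epsilon>
    by (simp add: eventually_sequentially)
  have "\<forall>\<^sub>F n in sequentially. \<kappa> n < ennreal (\<epsilon> / 2)"
    using \<kappa> \<epsilon> unfolding ennreal_tendsto_0_iff by simp
  then obtain n0 where n0: "\<And>n. n0 \<le> n \<Longrightarrow> \<kappa> n < ennreal (\<epsilon> / 2)"
    by (auto simp: eventually_sequentially)
  obtain kB where kB: "\<And>k. kB \<le> k \<Longrightarrow> measure B (- cball 0 (real k)) < \<epsilon> / 2" using tail[OF B] by blast
  obtain km where km: "\<And>n k. km n \<le> k \<Longrightarrow> measure (m n) (- cball 0 (real k)) < \<epsilon> / 2" using tail[OF m] by metis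
  define k where "k = max kB (Max (km ` {..n0}))"
  have "measure (m n) (UNIV - cball 0 (real k + 1)) < \<epsilon>" for n
  proof (cases "n0 \<le> n")
    case True
    have "emeasure (m n) (- cball 0 (real k + 1)) \<le> emeasure B (- cball 0 (real k)) + \<kappa> n" by (rule le)
    also have "\<dots> < ennreal (\<epsilon> / 2) + ennreal (\<epsilon> / 2)"
      using kB[of k] n0[OF True] unfolding em[OF B]
      by (intro add_strict_mono) (auto simp: k_def ennreal_less_iff)
    also have "\<dots> = ennreal \<epsilon>" using \<epsilon> by (simp flip: ennreal_plus)
    finally show ?thesis unfolding em[OF m] by (simp add: ennreal_less_iff Compl_eq_Diff_UNIV)
  next
    case False
    then have "km n \<le> Max (km ` {..n0})" by (intro Max_ge) auto
    then have "measure (m n) (- cball 0 (real (Suc k))) < \<epsilon> / 2" by (intro km) (simp add: k_def)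
    then show ?thesis using \<epsilon> by (simp add: Compl_eq_Diff_UNIV add.commute)
  qed
  then show "\<exists>K. compact K \<and> (\<forall>n. measure (m n) (UNIV - K) < \<epsilon>)"
    by (intro exI[of _ "cball 0 (real k + 1)"]) simp
qed

text \<open>
  Mutual singularity gives disjoint compact sets carrying almost all of \<open>B\<close> and \<open>B'\<close>; they lie at
  positive distance, so moving mass from one to the other is not free.
\<close>

lemma tendsto_0_of_separated_bound:
  fixes B B' :: "'a::euclidean_space measure" and V \<kappa> :: "nat \<Rightarrow> ennreal"
  assumes a: "0 < a" and B: "B \<in> fin_borel_measures" and B': "B' \<in> fin_borel_measures"
    and H: "H \<in> sets borel" "measure B H = 0" "measure B' (- H) = 0"
    and V: "V \<longlonglongrightarrow> 0" and \<kappa>: "\<kappa> \<longlonglongrightarrow> 0"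
    and bound: "\<And>n S T \<delta>. S \<in> sets borel \<Longrightarrow> T \<in> sets borel \<Longrightarrow> 0 < \<delta> \<Longrightarrow>
      (\<And>x y. x \<notin> S \<Longrightarrow> y \<notin> T \<Longrightarrow> \<delta> \<le> dist x y) \<Longrightarrow>
      f n \<le> V n + ennreal a * (emeasure B S + emeasure B' T + ennreal (1 / \<delta>) * \<kappa> n)"
  shows "f \<longlonglongrightarrow> 0"
  unfolding ennreal_tendsto_0_iff
proof (intro allI impI)
  fix e :: real assume e: "0 < e"
  \<comment> \<open>The two tails then contribute at most
    \<open>a * (\<epsilon> + \<epsilon>) = e / 2\<close>; the other half of \<open>e\<close> is for
    \<open>V\<close> and \<open>\<kappa>\<close>.\<close>
  define \<epsilon> where "\<epsilon> = e / (4 * a)"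
  have \<epsilon>: "0 < \<epsilon>" using e a by (simp add: \<epsilon>_def)
  \<comment> \<open>\<open>B\<close> lives on \<open>- H\<close> and \<open>B'\<close> on
    \<open>H\<close>; inner regularity on either side keeps the two compact sets disjoint.\<close>
  have "- H \<in> sets borel" "measure B (- (- H)) = 0" using H by auto
  then obtain K where K: "compact K" "K \<subseteq> - H" "measure B (- K) < \<epsilon>"
    using fin_borel_inner_compact[OF B _ _ \<epsilon>] by blast
  obtain K' where K': "compact K'" "K' \<subseteq> H" "measure B' (- K') < \<epsilon>"
    using fin_borel_inner_compact[OF B' H(1,3) \<epsilon>] by blast
  obtain \<delta> where \<delta>: "0 < \<delta>" "\<And>x y. x \<in> K \<Longrightarrow> y \<in> K' \<Longrightarrow> \<delta> \<le> dist x y"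
    using separate_compact_closed[OF K(1) compact_imp_closed[OF K'(1)]] K(2) K'(2) by blast
  \<comment> \<open>The compact sets, and hence \<open>\<delta>\<close>, depend on \<open>e\<close>
    but not on \<open>n\<close>, so \<open>a / \<delta>\<close> is a constant factor in front of a
    null sequence.\<close>
  have "(\<lambda>n. V n + ennreal (a / \<delta>) * \<kappa> n) \<longlonglongrightarrow> 0 + ennreal (a / \<delta>) * 0"
    by (intro tendsto_add V ennreal_tendsto_cmult \<kappa>) simp
  then have "(\<lambda>n. V n + ennreal (a / \<delta>) * \<kappa> n) \<longlonglongrightarrow> 0" by simp
  then have ev: "\<forall>\<^sub>F n in sequentially. V n + ennreal (a / \<delta>) * \<kappa> n < ennreal (e / 2)"
    using e unfolding ennreal_tendsto_0_iff by simp
  have add_less: "x + y < y + y" if "x < y" "y \<noteq> top" for x y :: ennreal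
    using that by (simp add: ennreal_add_left_cancel_less add.commute[of x])
  from ev show "\<forall>\<^sub>F n in sequentially. f n < ennreal e"
  proof eventually_elim
    case (elim n)
    have "f n \<le> V n + ennreal a * (emeasure B (- K) + emeasure B' (- K') + ennreal (1 / \<delta>) * \<kappa> n)"
      using K(1) K'(1) \<delta> by (intro bound) (auto intro: borel_comp borel_compact)
    also have "\<dots> = (V n + ennreal (a / \<delta>) * \<kappa> n) + ennreal a * (emeasure B (- K) + emeasure B' (- K'))"
      using a \<delta>(1) by (simp add: distrib_left add_ac mult.assoc[symmetric] flip: ennreal_mult)
    also have "ennreal a * (emeasure B (- K) + emeasure B' (- K')) \<le> ennreal (e / 2)"
    proof -
      have "ennreal a * (emeasure B (- K) + emeasure B' (- K')) = ennreal (a * (measure B (- K) + measure B' (- K')))"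
        using a by (simp add: ennreal_mult finite_measure.emeasure_eq_measure[OF fin_borel_measuresD(2)] B B')
      also have "a * (measure B (- K) + measure B' (- K')) \<le> a * (\<epsilon> + \<epsilon>)"
        using a K(3) K'(3) by (intro mult_left_mono) auto
      also have "a * (\<epsilon> + \<epsilon>) = e / 2" using a by (simp add: \<epsilon>_def)
      finally show ?thesis by (simp add: ennreal_leI)
    qed
    also have "(V n + ennreal (a / \<delta>) * \<kappa> n) + ennreal (e / 2) < ennreal (e / 2) + ennreal (e / 2)"
      by (rule add_less[OF elim]) simp
    also have "\<dots> = ennreal e" using e by (simp flip: ennreal_plus)
    finally show ?case by (simp add: add_left_mono)
  qed
qed

section \<open>The two implications\<close>

lemma norm_ab_tendsto_0_imp_split:
  fixes \<mu>s :: "nat \<Rightarrow> 'a::euclidean_space set \<Rightarrow> real"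
  assumes ab: "0 < a" "0 < b"
    and jordan: "jordan_decomposition \<mu> \<mu>_pos \<mu>_neg"
    and dec: "\<And>n. decomposes (\<mu>s n) (\<mu>s_pos n) (\<mu>s_neg n)"
    and lim: "(\<lambda>n. norm_ab a b (\<lambda>A. \<mu>s n A - \<mu> A)) \<longlonglongrightarrow> 0"
  shows "\<exists>z_pos z_neg m_pos m_neg.
       (\<forall>n. z_pos n \<in> fin_borel_measures \<and> z_neg n \<in> fin_borel_measures \<and>
            m_pos n \<in> fin_borel_measures \<and> m_neg n \<in> fin_borel_measures \<and>
            is_measure_sum (\<mu>s_pos n) (z_pos n) (m_pos n) \<and>
            is_measure_sum (\<mu>s_neg n) (z_neg n) (m_neg n)) \<and>
       ((\<lambda>n. W1ab a b (z_pos n) (z_neg n)) \<longlonglongrightarrow> 0) \<and>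
       ((\<lambda>n. W1ab a b (m_pos n) \<mu>_pos) \<longlonglongrightarrow> 0) \<and>
       ((\<lambda>n. W1ab a b (m_neg n) \<mu>_neg) \<longlonglongrightarrow> 0) \<and>
       tight_seq m_pos \<and> tight_seq m_neg \<and>
       bounded_in_mass m_pos \<and> bounded_in_mass m_neg"
proof -
  have A: "\<mu>s_pos n \<in> fin_borel_measures" and A': "\<mu>s_neg n \<in> fin_borel_measures" for n
    using dec[of n] by (auto simp: decomposes_def)
  have B': "\<mu>_pos \<in> fin_borel_measures" and B: "\<mu>_neg \<in> fin_borel_measures" and dec\<mu>: "decomposes \<mu> \<mu>_pos \<mu>_neg"
    using jordan by (auto simp: jordan_decomposition_def decomposes_def)
  obtain H where H: "H \<in> sets borel" "measure \<mu>_pos (- H) = 0" "measure \<mu>_neg H = 0"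
    using jordan by (auto simp: jordan_decomposition_def)
  obtain P where P: "\<And>n. P n \<in> fin_borel_measures" "\<And>n. is_measure_sum (P n) (\<mu>s_pos n) \<mu>_neg"
    using measure_sum_exists[OF A B] by metis
  obtain N where N: "\<And>n. N n \<in> fin_borel_measures" "\<And>n. is_measure_sum (N n) (\<mu>s_neg n) \<mu>_pos"
    using measure_sum_exists[OF A' B'] by metis
  have decPN: "decomposes (\<lambda>A. \<mu>s n A - \<mu> A) (P n) (N n)" for n
    by (rule decomposes_diff[OF dec dec\<mu> P N])
  \<comment> \<open>The plans are only nearly optimal; the slack \<open>1 / (n + 1)\<close> is
    chosen to vanish with \<open>n\<close>.\<close>
  have "\<exists>w. is_plan (P n) (N n) w \<and> plan_cost a b (P n) (N n) w
      \<le> norm_ab a b (\<lambda>A. \<mu>s n A - \<mu> A) + ennreal (1 / real (Suc n))" for n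
    by (rule plan_le_norm_ab[OF ab _ decPN]) simp
  then obtain w where w: "\<And>n. is_plan (P n) (N n) (w n)"
    and cost: "\<And>n. plan_cost a b (P n) (N n) (w n) \<le> norm_ab a b (\<lambda>A. \<mu>s n A - \<mu> A) + ennreal (1 / real (Suc n))"
    by metis
  define V where "V n = plan_cost a b (P n) (N n) (w n)" for n
  define \<kappa> where "\<kappa> n = (\<integral>\<^sup>+ x. \<integral>\<^sup>+ y. w n x y * ennreal (dist x y) \<partial>N n \<partial>P n)" for n
  have V: "V \<longlonglongrightarrow> 0"
  proof (rule tendsto_sandwich[OF _ _ tendsto_const])
    have "(\<lambda>n. ennreal (1 / real (Suc n))) \<longlonglongrightarrow> ennreal 0"
      by (intro tendsto_ennrealI LIMSEQ_inverse_real_of_nat[unfolded inverse_eq_divide])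
    from tendsto_add[OF lim this]
    show "(\<lambda>n. norm_ab a b (\<lambda>A. \<mu>s n A - \<mu> A) + ennreal (1 / real (Suc n))) \<longlonglongrightarrow> 0" by simp
    show "\<forall>\<^sub>F n in sequentially. V n \<le> norm_ab a b (\<lambda>A. \<mu>s n A - \<mu> A) + ennreal (1 / real (Suc n))"
      unfolding V_def by (intro always_eventually allI cost)
  qed simp
  have \<kappa>: "\<kappa> \<longlonglongrightarrow> 0"
  proof (rule tendsto_sandwich[OF _ _ tendsto_const])
    \<comment> \<open>Here \<open>0 < b\<close> turns smallness of the total cost into smallness of
      the distance travelled.\<close>
    have "\<kappa> n = ennreal (1 / b) * (ennreal b * \<kappa> n)" for n
      using ab by (simp add: mult.assoc[symmetric] flip: ennreal_mult)
    also have "\<dots> n \<le> ennreal (1 / b) * V n" for n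
      by (intro mult_left_mono) (auto simp: V_def plan_cost_def \<kappa>_def)
    finally show "\<forall>\<^sub>F n in sequentially. \<kappa> n \<le> ennreal (1 / b) * V n" by simp
    have "(\<lambda>n. ennreal (1 / b) * V n) \<longlonglongrightarrow> ennreal (1 / b) * 0"
      by (intro ennreal_tendsto_cmult V) simp
    then show "(\<lambda>n. ennreal (1 / b) * V n) \<longlonglongrightarrow> 0" by simp
  qed simp
  \<comment> \<open>Two readings of one plan: \<open>split_swap\<close> exchanges source and target
    and transposes \<open>w\<close>, so the estimates for the positive parts also give those for the
    negative parts. \<open>swap\<close> identifies the costs.\<close>
  note split = ab A B A' B' P(1) N(1) P(2) N(2) w
  note split_swap = ab A' B' A B N(1) P(1) N(2) P(2) is_plan_swap[OF w]
  note swap = plan_cost_swap[OF P(1) N(1) w]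
  let ?m_pos = "\<lambda>n. density (\<mu>s_pos n) (\<lambda>x. \<integral>\<^sup>+ y. w n x y \<partial>\<mu>_pos)"
  let ?z_pos = "\<lambda>n. density (\<mu>s_pos n) (\<lambda>x. 1 - (\<integral>\<^sup>+ y. w n x y \<partial>\<mu>_pos))"
  let ?m_neg = "\<lambda>n. density (\<mu>s_neg n) (\<lambda>y. \<integral>\<^sup>+ x. w n x y \<partial>\<mu>_neg)"
  let ?z_neg = "\<lambda>n. density (\<mu>s_neg n) (\<lambda>y. 1 - (\<integral>\<^sup>+ x. w n x y \<partial>\<mu>_neg))"
  have m_pos: "?m_pos n \<in> fin_borel_measures" and z_pos: "?z_pos n \<in> fin_borel_measures"
    and m_neg: "?m_neg n \<in> fin_borel_measures" and z_neg: "?z_neg n \<in> fin_borel_measures" for n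
    by (rule matched_in_fin_borel[OF split] matched_in_fin_borel[OF split_swap])+
  have "is_measure_sum (\<mu>s_pos n) (?z_pos n) (?m_pos n)" "is_measure_sum (\<mu>s_neg n) (?z_neg n) (?m_neg n)" for n
    by (rule is_measure_sum_unmatched_matched[OF split] is_measure_sum_unmatched_matched[OF split_swap])+
  moreover have "(\<lambda>n. W1ab a b (?z_pos n) (?z_neg n)) \<longlonglongrightarrow> 0"
  proof (rule tendsto_sandwich[OF _ _ tendsto_const V])
    show "\<forall>\<^sub>F n in sequentially. W1ab a b (?z_pos n) (?z_neg n) \<le> V n"
      unfolding V_def by (intro always_eventually allI W1ab_unmatched_le[OF split])
  qed simp
  moreover have "(\<lambda>n. W1ab a b (?m_pos n) \<mu>_pos) \<longlonglongrightarrow> 0"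
    by (rule tendsto_0_of_separated_bound[OF ab(1) B B' H(1,3,2) V \<kappa>])
      (unfold V_def \<kappa>_def, rule W1ab_matched_le[OF split])
  moreover have "(\<lambda>n. W1ab a b (?m_neg n) \<mu>_neg) \<longlonglongrightarrow> 0"
  proof (rule tendsto_0_of_separated_bound[OF ab(1) B' B _ _ _ V \<kappa>])
    \<comment> \<open>The singular measures have traded places, so the separating set is
      complemented.\<close>
    show "- H \<in> sets borel" "measure \<mu>_pos (- H) = 0" "measure \<mu>_neg (- (- H)) = 0" using H by auto
    fix n and S T :: "'a set" and \<delta> :: real
    assume *: "S \<in> sets borel" "T \<in> sets borel" "0 < \<delta>" "\<And>x y. x \<notin> S \<Longrightarrow> y \<notin> T \<Longrightarrow> \<delta> \<le> dist x y"
    show "W1ab a b (?m_neg n) \<mu>_neg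
       \<le> V n + ennreal a * (emeasure \<mu>_pos S + emeasure \<mu>_neg T + ennreal (1 / \<delta>) * \<kappa> n)"
      unfolding V_def \<kappa>_def by (rule W1ab_matched_le[OF split_swap, unfolded swap]) (use * in auto)
  qed
  moreover have "tight_seq ?m_pos"
    by (rule tight_seqI[OF B' m_pos _ \<kappa>]) (unfold \<kappa>_def, rule emeasure_matched_le(2)[OF split])
  moreover have "tight_seq ?m_neg"
  proof (rule tight_seqI[OF B m_neg _ \<kappa>])
    show "emeasure (?m_neg n) (- cball 0 (R + 1)) \<le> emeasure \<mu>_neg (- cball 0 R) + \<kappa> n" for n R
      using emeasure_matched_le(2)[OF split_swap, of n R] by (simp only: swap \<kappa>_def)
  qed
  moreover have "bounded_in_mass ?m_pos" "bounded_in_mass ?m_neg"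
    by (rule bounded_in_massI[OF B' emeasure_matched_le(1)[OF split]]
        bounded_in_massI[OF B emeasure_matched_le(1)[OF split_swap]])+
  ultimately show ?thesis
    using m_pos m_neg z_pos z_neg
    by (intro exI[of _ ?z_pos] exI[of _ ?z_neg] exI[of _ ?m_pos] exI[of _ ?m_neg]) blast
qed

text \<open>The difference is the sum of \<open>z_pos - z_neg\<close>,
  \<open>m_pos - \<mu>_pos\<close> and \<open>\<mu>_neg - m_neg\<close>, each small by hypothesis.
  Adding the three flows gives a plan for whatever decomposition \<open>norm_ab\<close> has
  picked.\<close>

lemma split_imp_norm_ab_tendsto_0:
  fixes \<mu>s :: "nat \<Rightarrow> 'a::euclidean_space set \<Rightarrow> real"
  assumes ab: "0 < a" "0 < b"
    and dec\<mu>: "decomposes \<mu> \<mu>_pos \<mu>_neg"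
    and dec: "\<And>n. decomposes (\<mu>s n) (\<mu>s_pos n) (\<mu>s_neg n)"
    and fin: "\<And>n. z_pos n \<in> fin_borel_measures" "\<And>n. z_neg n \<in> fin_borel_measures"
      "\<And>n. m_pos n \<in> fin_borel_measures" "\<And>n. m_neg n \<in> fin_borel_measures"
    and sum: "\<And>n. is_measure_sum (\<mu>s_pos n) (z_pos n) (m_pos n)"
      "\<And>n. is_measure_sum (\<mu>s_neg n) (z_neg n) (m_neg n)"
    and lim: "(\<lambda>n. W1ab a b (z_pos n) (z_neg n)) \<longlonglongrightarrow> 0" "(\<lambda>n. W1ab a b (m_pos n) \<mu>_pos) \<longlonglongrightarrow> 0"
      "(\<lambda>n. W1ab a b (m_neg n) \<mu>_neg) \<longlonglongrightarrow> 0"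
  shows "(\<lambda>n. norm_ab a b (\<lambda>A. \<mu>s n A - \<mu> A)) \<longlonglongrightarrow> 0"
  unfolding ennreal_tendsto_0_iff
proof (intro allI impI)
  fix e :: real assume e: "0 < e"
  \<comment> \<open>Three quarters of \<open>e\<close> go to the three limits, the last to the loss
    in building a plan.\<close>
  have e4: "0 < e / 4" using e by simp
  have "\<forall>\<^sub>F n in sequentially. W1ab a b (z_pos n) (z_neg n) < ennreal (e / 4)"
    "\<forall>\<^sub>F n in sequentially. W1ab a b (m_pos n) \<mu>_pos < ennreal (e / 4)"
    "\<forall>\<^sub>F n in sequentially. W1ab a b (m_neg n) \<mu>_neg < ennreal (e / 4)"
    using lim e4 unfolding ennreal_tendsto_0_iff by blast+
  then show "\<forall>\<^sub>F n in sequentially. norm_ab a b (\<lambda>A. \<mu>s n A - \<mu> A) < ennreal e"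
  proof eventually_elim
    case (elim n)
    have A: "\<mu>s_pos n \<in> fin_borel_measures" and A': "\<mu>s_neg n \<in> fin_borel_measures"
      and B: "\<mu>_pos \<in> fin_borel_measures" and B': "\<mu>_neg \<in> fin_borel_measures"
      using dec[of n] dec\<mu> by (auto simp: decomposes_def)
    obtain P where P: "P \<in> fin_borel_measures" "is_measure_sum P (\<mu>s_pos n) \<mu>_neg"
      using measure_sum_exists[OF A B'] by blast
    obtain N where N: "N \<in> fin_borel_measures" "is_measure_sum N (\<mu>s_neg n) \<mu>_pos"
      using measure_sum_exists[OF A' B] by blast
    \<comment> \<open>\<open>P\<close> and \<open>N\<close> serve to show that the difference has a
      decomposition; the plan is built for the pair \<open>M\<close>, \<open>L\<close> behind
      \<open>norm_ab\<close>.\<close>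
    obtain M L where M: "decomposes (\<lambda>A. \<mu>s n A - \<mu> A) M L" "norm_ab a b (\<lambda>A. \<mu>s n A - \<mu> A) = W1ab a b M L"
      by (rule norm_ab_obtains[OF decomposes_diff[OF dec dec\<mu> P N]])
    have finite_dec: "M \<in> fin_borel_measures" "L \<in> fin_borel_measures"
      and "(\<lambda>A. \<mu>s n A - \<mu> A) = (\<lambda>A. measure M A - measure L A)"
      using M(1) by (auto simp: decomposes_def)
    then have eqd: "measure M A - measure L A = \<mu>s n A - \<mu> A" for A by (metis (no_types))
    have "(measure (z_pos n) A - measure (z_neg n) A) + (measure (m_pos n) A - measure \<mu>_pos A)
      + (measure \<mu>_neg A - measure (m_neg n) A) = measure M A - measure L A" if "A \<in> sets borel" for A
    proof -
      have "\<mu>s n A = measure (\<mu>s_pos n) A - measure (\<mu>s_neg n) A" "\<mu> A = measure \<mu>_pos A - measure \<mu>_neg A"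
        using dec[of n] dec\<mu> by (auto simp: decomposes_def)
      then show ?thesis
        unfolding eqd using measure_is_measure_sum[OF sum(1) fin(1,3) that] measure_is_measure_sum[OF sum(2) fin(2,4) that]
        by simp
    qed
    \<comment> \<open>The last pair enters with its measures exchanged, since negative parts are
      subtracted.\<close>
    from plan_exists_sum3[OF ab e4 finite_dec this elim(1,2) elim(3)[unfolded W1ab_commute[of a b "m_neg n"]]]
    obtain w where "is_plan M L w" "plan_cost a b M L w < ennreal (e / 4 + e / 4 + e / 4 + e / 4)" by blast
    then show ?case
      unfolding M(2) using W1ab_le_plan_cost[OF _ _ finite_dec, of a b w] ab by (auto intro: order_le_less_trans)
  qed
qed

theorem theorem30:
  fixes a b :: real
    and \<mu>s :: "nat \<Rightarrow> (real ^ 'd) set \<Rightarrow> real"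
    and \<mu> :: "(real ^ 'd) set \<Rightarrow> real"
    and \<mu>s_pos \<mu>s_neg :: "nat \<Rightarrow> (real ^ 'd) measure"
    and \<mu>_pos \<mu>_neg :: "(real ^ 'd) measure"
  assumes "a > 0" and "b > 0"
    and "\<And>n. \<mu>s n \<in> signed_measures"
    and "\<mu> \<in> signed_measures"
    and "jordan_decomposition \<mu> \<mu>_pos \<mu>_neg"
    and "\<And>n. decomposes (\<mu>s n) (\<mu>s_pos n) (\<mu>s_neg n)"
  shows "((\<lambda>n. norm_ab a b (\<lambda>A. \<mu>s n A - \<mu> A)) \<longlonglongrightarrow> 0) \<longleftrightarrow>
    (\<exists>z_pos z_neg m_pos m_neg :: nat \<Rightarrow> (real ^ 'd) measure.
       (\<forall>n. z_pos n \<in> fin_borel_measures \<and> z_neg n \<in> fin_borel_measures \<and>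
            m_pos n \<in> fin_borel_measures \<and> m_neg n \<in> fin_borel_measures \<and>
            is_measure_sum (\<mu>s_pos n) (z_pos n) (m_pos n) \<and>
            is_measure_sum (\<mu>s_neg n) (z_neg n) (m_neg n)) \<and>
       ((\<lambda>n. W1ab a b (z_pos n) (z_neg n)) \<longlonglongrightarrow> 0) \<and>
       ((\<lambda>n. W1ab a b (m_pos n) \<mu>_pos) \<longlonglongrightarrow> 0) \<and>
       ((\<lambda>n. W1ab a b (m_neg n) \<mu>_neg) \<longlonglongrightarrow> 0) \<and>
       tight_seq m_pos \<and> tight_seq m_neg \<and>
       bounded_in_mass m_pos \<and> bounded_in_mass m_neg)"
    (is "?lim \<longleftrightarrow> ?split")
proof
  assume ?lim
  then show ?split by (rule norm_ab_tendsto_0_imp_split[OF assms(1,2,5,6)])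
next
  assume ?split
  then obtain z_pos z_neg m_pos m_neg :: "nat \<Rightarrow> (real ^ 'd) measure" where
    *: "\<And>n. z_pos n \<in> fin_borel_measures" "\<And>n. z_neg n \<in> fin_borel_measures"
      "\<And>n. m_pos n \<in> fin_borel_measures" "\<And>n. m_neg n \<in> fin_borel_measures"
      "\<And>n. is_measure_sum (\<mu>s_pos n) (z_pos n) (m_pos n)"
      "\<And>n. is_measure_sum (\<mu>s_neg n) (z_neg n) (m_neg n)"
      "(\<lambda>n. W1ab a b (z_pos n) (z_neg n)) \<longlonglongrightarrow> 0" "(\<lambda>n. W1ab a b (m_pos n) \<mu>_pos) \<longlonglongrightarrow> 0"
      "(\<lambda>n. W1ab a b (m_neg n) \<mu>_neg) \<longlonglongrightarrow> 0"
    by blast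
  have "decomposes \<mu> \<mu>_pos \<mu>_neg" using assms(5) by (simp add: jordan_decomposition_def)
  then show ?lim by (rule split_imp_norm_ab_tendsto_0[OF assms(1,2) _ assms(6) *])
qed

end
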